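(* Let $\lambda/\mu$ be a connected r-shape, $\tilde{\mathbf a},\tilde{\mathbf b}$ strict flags for it, and $\Theta=(\theta_1,\ldots,\theta_k)$ an outer ribbon decomposition of $\lambda/\mu$. Then $$\mathsf S^{\tilde{\mathbf a},\tilde{\mathbf b}}_{\lambda/\mu}(\mathbf y/\mathbf z)=\det\left[\mathsf S^{\tilde{\mathbf a}^{ij},\tilde{\mathbf b}^{ij}}_{\theta_i\#\theta_j}(\mathbf y/\mathbf z)\right]_{1\le i,j\le k},$$ with entries $1$ when $\theta_i\#\theta_j=\varnothing$ and $0$ when it is undefined.
   Context: Young diagrams in English notation; $\mathrm{row},\mathrm{col}$ of a cell. An r-shape is $(\lambda/\mu,r)$ with shifted contents $c(i,j)=j-i+r-1+\lambda'_1$; connected = edgewise connected. Column flags for an r-shape $\kappa/\nu$: $\mathbf a,\mathbf b\in\mathbb Z^N$, $N\ge\kappa_1$, with $a_i-a_{i+1}\le\nu'_i-\nu'_{i+1}+1$, $b_i-b_{i+1}\le\kappa'_i-\kappa'_{i+1}+1$ whenever $\nu'_i<\kappa'_{i+1}$; conjugates $a'_i=a_i+c(\gamma_i)$, $b'_i=b_i+c(\delta_i)$, $\gamma_i,\delta_i$ top/bottom cells of column $i$. Strict flags: column flags $\tilde{\mathbf a},\tilde{\mathbf b}$ such that moreover $\tilde a_i-\tilde a_{i+1}\le1$ for all $i$. $\mathbf y_{a,b}=(y_a,\ldots,y_b)$ (empty if $a>b$); $e_n(\mathbf x/\mathbf w)=\sum_{i=0}^n(-1)^{n-i}e_i(\mathbf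 x)h_{n-i}(\mathbf w)$. $\mathsf S^{\mathbf a,\mathbf b}_{\kappa/\nu}(\mathbf y/\mathbf z)=\det[e_{\kappa'_i-i-\nu'_j+j}(\mathbf y_{a_j,b_i}/\mathbf z_{a'_j,b'_i})]_{1\le i,j\le N}$. Ribbons: edgewise connected skew diagrams with no $2\times2$ block; head = bottom-left, tail = top-right cell. A cell is on the top (right, bottom, left) perimeter if the neighbour above (right, below, left) is not in $\lambda/\mu$. An outer ribbon decomposition partitions the cells into ribbons with heads on the left/bottom perimeter and tails on the top/right perimeter. A cell $\gamma\in\theta_i$ goes up if the cell above is in $\theta_i$ or $\gamma$ is the tail of $\theta_i$ on the top perimeter; goes right if the cell right of it is in $\theta_i$ or $\gamma$ is the tail on the right perimeter; the top-right cell of $\lambda/\mu$ goes up if the cell below it is in its ribbon, right if the cell left of it is. Equal-content cells go in the same direction. The cutting strip is the ribbon with exactly the contents of $\lambda/\mu$, the content-$(c+1)$ cell directly above (right of) the content-$c$ cell when content-$c$ cells go up (right). $\Theta(p,q)$: sub-ribbon with contents in $[p,q]$ (r-shape with root content $p$); $\varnothing$ if $p=q+1$, undefined if $p>q+1$. $\theta_i\#\theta_j=\Theta(c(\delta_i),c(\gamma_j))$, $\delta_i$ head of $\theta_i$, $\gamma_j$ tail of $\theta_j$. Canonical decomposition $\theta_i\#\theta_j=\rho_1\to\cdots\to\rho_K$: maximal vertical strips from left to right; $\delta_r,\gamma_r$ bottom/top cells of $\rho_r$. Induced strict ribbon flags: $\tilde a^{ij}_r=\tilde a_{\mathrm{col}(m_r)}$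 where $m_r$ is the leftmost cell of $\lambda/\mu$ with content $c(\gamma_r)$; $\tilde b^{ij}_r=\tilde b_{\mathrm{col}(M_r)}-\lambda'_{\mathrm{col}(M_r)}+\mathrm{row}(M_r)$ where $M_r$ is the rightmost cell of $\lambda/\mu$ with content $c(\delta_r)$ (rows/columns measured in $\lambda/\mu$). *)

theory Defs
  imports Main "Jordan_Normal_Form.Determinant"
begin

section \<open>Partitions, Young diagrams (English notation), cells = (row, col), 1-indexed\<close>

type_synonym cell = "nat \<times> nat"

definition is_partition :: "nat list \<Rightarrow> bool" where
  "is_partition lam \<longleftrightarrow> sorted_wrt (\<lambda>x y. y \<le> x) lam \<and> (\<forall>x\<in>set lam. 0 < x)"

text \<open>row length \<open>lam_i\<close> (0 outside the list)\<close>
definition prow :: "nat list \<Rightarrow> nat \<Rightarrow> nat" where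
  "prow lam i = (if 1 \<le> i \<and> i \<le> length lam then lam ! (i - 1) else 0)"

text \<open>conjugate \<open>lam'_j\<close> (column length), for \<open>j \<ge> 1\<close>\<close>
definition pconj :: "nat list \<Rightarrow> nat \<Rightarrow> nat" where
  "pconj lam j = card {i \<in> {1..length lam}. j \<le> prow lam i}"

definition subpart :: "nat list \<Rightarrow> nat list \<Rightarrow> bool" where
  "subpart mu lam \<longleftrightarrow> (\<forall>i. prow mu i \<le> prow lam i)"

definition skew :: "nat list \<Rightarrow> nat list \<Rightarrow> cell set" where
  "skew lam mu = {(i, j). 1 \<le> i \<and> prow mu i < j \<and> j \<le> prow lam i}"

definition is_skew_diagram :: "cell set \<Rightarrow> bool" where
  "is_skew_diagram D \<longleftrightarrow> (\<exists>kap nu. is_partition kap \<and> is_partition nu \<and> subpart nu kap \<and> D = skew kap nu)"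

text \<open>shifted content of the r-shape \<open>(lam/mu, r)\<close>: \<open>c(i,j) = j - i + r - 1 + lam'_1\<close>\<close>
definition rcontent :: "nat list \<Rightarrow> int \<Rightarrow> cell \<Rightarrow> int" where
  "rcontent lam r c = int (snd c) - int (fst c) + r - 1 + int (pconj lam 1)"

section \<open>Connectedness, ribbons\<close>

definition edge_adj :: "cell \<Rightarrow> cell \<Rightarrow> bool" where
  "edge_adj x y \<longleftrightarrow>
     (fst x = fst y \<and> (snd y = snd x + 1 \<or> snd x = snd y + 1)) \<or>
     (snd x = snd y \<and> (fst y = fst x + 1 \<or> fst x = fst y + 1))"

definition edge_connected :: "cell set \<Rightarrow> bool" where
  "edge_connected D \<longleftrightarrow> D \<noteq> {} \<and>
     (\<forall>x\<in>D. \<forall>y\<in>D. (x, y) \<in> {(u, v). u \<in> D \<and> v \<in> D \<and> edge_adj u v}\<^sup>*)"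

definition no_2x2 :: "cell set \<Rightarrow> bool" where
  "no_2x2 R \<longleftrightarrow> \<not> (\<exists>i j. (i, j) \<in> R \<and> (i + 1, j) \<in> R \<and> (i, j + 1) \<in> R \<and> (i + 1, j + 1) \<in> R)"

definition is_ribbon :: "cell set \<Rightarrow> bool" where
  "is_ribbon R \<longleftrightarrow> is_skew_diagram R \<and> edge_connected R \<and> no_2x2 R"

text \<open>bottom-left cell (lowest row, leftmost in it) and top-right cell (highest row, rightmost in it)\<close>
definition rhead :: "cell set \<Rightarrow> cell" where
  "rhead R = (THE g. g \<in> R \<and> (\<forall>d\<in>R. fst d \<le> fst g \<and> (fst d = fst g \<longrightarrow> snd g \<le> snd d)))"

definition rtail :: "cell set \<Rightarrow> cell" where
  "rtail R = (THE g. g \<in> R \<and> (\<forall>d\<in>R. fst g \<le> fst d \<and> (fst d = fst g \<longrightarrow> snd d \<le> snd g)))"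

text \<open>perimeters of a cell set D\<close>
definition on_top :: "cell set \<Rightarrow> cell \<Rightarrow> bool" where
  "on_top D g \<longleftrightarrow> (fst g - 1, snd g) \<notin> D"
definition on_bottom :: "cell set \<Rightarrow> cell \<Rightarrow> bool" where
  "on_bottom D g \<longleftrightarrow> (fst g + 1, snd g) \<notin> D"
definition on_left :: "cell set \<Rightarrow> cell \<Rightarrow> bool" where
  "on_left D g \<longleftrightarrow> (fst g, snd g - 1) \<notin> D"
definition on_right :: "cell set \<Rightarrow> cell \<Rightarrow> bool" where
  "on_right D g \<longleftrightarrow> (fst g, snd g + 1) \<notin> D"

definition outer_ribbon_decomp :: "cell set \<Rightarrow> cell set list \<Rightarrow> bool" where
  "outer_ribbon_decomp D Th \<longleftrightarrow>
     (\<forall>t\<in>set Th. is_ribbon t \<and> t \<subseteq> D) \<and>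
     (\<forall>i<length Th. \<forall>j<length Th. i \<noteq> j \<longrightarrow> Th ! i \<inter> Th ! j = {}) \<and>
     \<Union> (set Th) = D \<and>
     (\<forall>t\<in>set Th. on_left D (rhead t) \<or> on_bottom D (rhead t)) \<and>
     (\<forall>t\<in>set Th. on_top D (rtail t) \<or> on_right D (rtail t))"

text \<open>a cell goes up (w.r.t. the decomposition); the top-right cell of D has its own rule\<close>
definition goes_up :: "cell set \<Rightarrow> cell set list \<Rightarrow> cell \<Rightarrow> bool" where
  "goes_up D Th g \<longleftrightarrow> (\<exists>t\<in>set Th. g \<in> t \<and>
     (if g = rtail D then (fst g + 1, snd g) \<in> t
      else (fst g - 1, snd g) \<in> t \<or> (g = rtail t \<and> on_top D g)))"

text \<open>content-c cells go up (all cells of equal content go in the same direction)\<close>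
definition content_up :: "cell set \<Rightarrow> cell set list \<Rightarrow> (cell \<Rightarrow> int) \<Rightarrow> int \<Rightarrow> bool" where
  "content_up D Th cont c \<longleftrightarrow> (\<exists>g\<in>D. cont g = c \<and> goes_up D Th g)"

section \<open>The sub-ribbon \<open>\<Theta>(p,q)\<close> of the cutting strip, as an r-shape with root content p\<close>

definition nup :: "(int \<Rightarrow> bool) \<Rightarrow> int \<Rightarrow> int \<Rightarrow> nat" where
  "nup up p c = card {c' \<in> {p..<c}. up c'}"
definition nrt :: "(int \<Rightarrow> bool) \<Rightarrow> int \<Rightarrow> int \<Rightarrow> nat" where
  "nrt up p c = card {c' \<in> {p..<c}. \<not> up c'}"

text \<open>position of the content-c cell in the normalised ribbon with contents [p,q]
  (head at row \<open>1 + #ups\<close>, column 1; content c+1 above c if up c, else right of it)\<close>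
definition strip_cell :: "(int \<Rightarrow> bool) \<Rightarrow> int \<Rightarrow> int \<Rightarrow> int \<Rightarrow> cell" where
  "strip_cell up p q c = (1 + nup up p q - nup up p c, 1 + nrt up p c)"

definition strip_cells :: "(int \<Rightarrow> bool) \<Rightarrow> int \<Rightarrow> int \<Rightarrow> cell set" where
  "strip_cells up p q = strip_cell up p q ` {p..q}"

text \<open>outer and inner partition of \<open>\<Theta>(p,q)\<close>\<close>
definition strip_outer :: "(int \<Rightarrow> bool) \<Rightarrow> int \<Rightarrow> int \<Rightarrow> nat list" where
  "strip_outer up p q = map (\<lambda>i. Max {snd g | g. g \<in> strip_cells up p q \<and> fst g = i}) [1..<2 + nup up p q]"
definition strip_inner :: "(int \<Rightarrow> bool) \<Rightarrow> int \<Rightarrow> int \<Rightarrow> nat list" where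
  "strip_inner up p q = map (\<lambda>i. Min {snd g | g. g \<in> strip_cells up p q \<and> fst g = i} - 1) [1..<2 + nup up p q]"

section \<open>Supersymmetric elementary functions and flagged determinants\<close>

definition esym :: "nat \<Rightarrow> 'a::comm_ring_1 list \<Rightarrow> 'a" where
  "esym k xs = (\<Sum>S | S \<subseteq> {..<length xs} \<and> card S = k. \<Prod>i\<in>S. xs ! i)"

definition hsym :: "nat \<Rightarrow> 'a::comm_ring_1 list \<Rightarrow> 'a" where
  "hsym k xs = (\<Sum>al | (\<forall>i. length xs \<le> i \<longrightarrow> al i = 0) \<and> (\<Sum>i<length xs. al i) = k.
                  \<Prod>i<length xs. (xs ! i) ^ al i)"

text \<open>\<open>e_n(x/w) = \<Sum>_{i=0}^n (-1)^{n-i} e_i(x) h_{n-i}(w)\<close> (zero for n < 0)\<close>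
definition esuper :: "int \<Rightarrow> 'a::comm_ring_1 list \<Rightarrow> 'a list \<Rightarrow> 'a" where
  "esuper n xs ws = (\<Sum>i\<in>{0..n}. (-1) ^ nat (n - i) * esym (nat i) xs * hsym (nat (n - i)) ws)"

text \<open>\<open>y_{a,b} = (y_a,...,y_b)\<close>, empty if a > b\<close>
definition vseg :: "(int \<Rightarrow> 'a) \<Rightarrow> int \<Rightarrow> int \<Rightarrow> 'a list" where
  "vseg y a b = map y [a..b]"

text \<open>\<open>S^{a,b}_{kap/nu}(y/z)\<close> for the r-shape \<open>(kap/nu, r)\<close> with flags of length N (indices 1..N);
  \<open>gamma_j = (nu'_j + 1, j)\<close> top cell and \<open>delta_i = (kap'_i, i)\<close> bottom cell of a column\<close>
definition Sflag :: "nat list \<Rightarrow> nat list \<Rightarrow> int \<Rightarrow> nat \<Rightarrow> (nat \<Rightarrow> int) \<Rightarrow> (nat \<Rightarrow> int)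
                      \<Rightarrow> (int \<Rightarrow> 'a::comm_ring_1) \<Rightarrow> (int \<Rightarrow> 'a) \<Rightarrow> 'a" where
  "Sflag kap nu r N a b y z = det (mat N N (\<lambda>(i0, j0).
     let i = i0 + 1; j = j0 + 1 in
     esuper (int (pconj kap i) - int i - int (pconj nu j) + int j)
       (vseg y (a j) (b i))
       (vseg z (a j + rcontent kap r (pconj nu j + 1, j)) (b i + rcontent kap r (pconj kap i, i)))))"

definition column_flags :: "nat list \<Rightarrow> nat list \<Rightarrow> nat \<Rightarrow> (nat \<Rightarrow> int) \<Rightarrow> (nat \<Rightarrow> int) \<Rightarrow> bool" where
  "column_flags kap nu N a b \<longleftrightarrow> prow kap 1 \<le> N \<and>
     (\<forall>i. 1 \<le> i \<and> i < N \<and> pconj nu i < pconj kap (i + 1) \<longrightarrow>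
        a i - a (i + 1) \<le> int (pconj nu i) - int (pconj nu (i + 1)) + 1 \<and>
        b i - b (i + 1) \<le> int (pconj kap i) - int (pconj kap (i + 1)) + 1)"

definition strict_flags :: "nat list \<Rightarrow> nat list \<Rightarrow> nat \<Rightarrow> (nat \<Rightarrow> int) \<Rightarrow> (nat \<Rightarrow> int) \<Rightarrow> bool" where
  "strict_flags kap nu N a b \<longleftrightarrow> column_flags kap nu N a b \<and>
     (\<forall>i. 1 \<le> i \<and> i < N \<longrightarrow> a i - a (i + 1) \<le> 1)"

section \<open>Matrix entries \<open>S_{theta_i # theta_j}\<close> with induced strict ribbon flags\<close>

definition sharp_entry :: "nat list \<Rightarrow> nat list \<Rightarrow> int \<Rightarrow> cell set list \<Rightarrow> (nat \<Rightarrow> int) \<Rightarrow> (nat \<Rightarrow> int)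
     \<Rightarrow> (int \<Rightarrow> 'a::comm_ring_1) \<Rightarrow> (int \<Rightarrow> 'a) \<Rightarrow> cell set \<Rightarrow> cell set \<Rightarrow> 'a" where
  "sharp_entry lam mu r Th a b y z ti tj =
     (let D = skew lam mu; cont = rcontent lam r;
          p = cont (rhead ti); q = cont (rtail tj) in
      if p = q + 1 then 1
      else if p > q + 1 then 0
      else
        (let up = content_up D Th cont;
             kap = strip_outer up p q; nu = strip_inner up p q;
             K = prow kap 1;
             cgam = (\<lambda>s. rcontent kap p (pconj nu s + 1, s));
             cdel = (\<lambda>s. rcontent kap p (pconj kap s, s));
             colL = (\<lambda>c. Min {snd g | g. g \<in> D \<and> cont g = c});
             cellR = (\<lambda>c. THE g. g \<in> D \<and> cont g = c \<and> (\<forall>d\<in>D. cont d = c \<longrightarrow> snd d \<le> snd g));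
             a' = (\<lambda>s. a (colL (cgam s)));
             b' = (\<lambda>s. let M = cellR (cdel s) in b (snd M) - int (pconj lam (snd M)) + int (fst M))
         in Sflag kap nu p K a' b' y z))"

end

theory Submission
  imports Defs
begin

text \<open>
  The top cell of a column is the leftmost cell on its diagonal and the bottom cell is the rightmost
  one on its diagonal.  Hence all determinants in the theorem are built from one matrix \<open>U\<close> indexed by
  contents: the entry \<open>U p l\<close>, for a vertical strip with contents \<open>p, \<dots>, l - 1\<close>, uses the flags
  attached to the diagonals \<open>p\<close> and \<open>l - 1\<close>.  All that matters about \<open>U\<close> is that it is upper unitriangular.
  The left-hand side is the minor of \<open>U\<close> with rows the contents \<open>I\<close> of the bottom cells of columns and
  columns the (shifted) contents \<open>J\<close> of their top cells.

  Let \<open>T\<close> be the set of those \<open>c + 1\<close> for which the cutting strip turns right at content \<open>c\<close>.  The ribbon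
  functions of the cutting strip are, up to sign, the entries of the principal pivot transform of \<open>U\<close>
  at \<open>T\<close>, which is reached by exchanging the elements of \<open>T\<close> one at a time.  It turns the minor \<open>(I, J)\<close>
  into the minor with rows \<open>(I - T) \<union> (T - J)\<close> and columns \<open>(J - T) \<union> (T - I)\<close>, and these are exactly the
  contents of the heads and the shifted contents of the tails of the ribbons in the decomposition.
  Finally, the ribbons run in parallel, so the sign of the pairing of heads with tails can be read off
  from the turns; it cancels the sign of the exchange.
\<close>

section \<open>Determinants indexed by lists\<close>

text \<open>Every pivot is a diagonal entry of a unitriangular matrix and hence 1; this is why the
  exchange works over any commutative ring, without division. The shift of the column labels
  produces this diagonal: a strip with contents \<open>p, ..., l - 1\<close> is empty for
  \<open>l = p\<close>, and where a strip turns right the top of the old column and the bottom of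
  the new one receive the same label. The obstacle is the signs. A Schur complement at
  \<open>t\<close> gives the negative of the wanted entry exactly for \<open>p < t < l\<close>, and
  ordering the labels creates further signs. The former are absorbed into \<open>flip\<close>, which
  therefore preserves unitriangularity and is its own inverse; the latter are carried by
  \<open>invs\<close> and by counts of labels up to \<open>t\<close>, whose parity turns out not to
  depend on the flips already made.\<close>

definition mdet :: "('i \<Rightarrow> 'j \<Rightarrow> 'a::comm_ring_1) \<Rightarrow> 'i list \<Rightarrow> 'j list \<Rightarrow> 'a" where
  "mdet F xs ys = det (mat (length xs) (length ys) (\<lambda>(i, j). F (xs ! i) (ys ! j)))"

lemma mdet_cong:
  assumes "\<And>x y. x \<in> set xs \<Longrightarrow> y \<in> set ys \<Longrightarrow> F x y = G x y"
  shows "mdet F xs ys = mdet G xs ys"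
  unfolding mdet_def using assms by (intro arg_cong[of _ _ det] eq_matI) auto

lemma mdet_map: "mdet F (map f xs) (map g ys) = mdet (\<lambda>x y. F (f x) (g y)) xs ys"
  unfolding mdet_def by (intro arg_cong[of _ _ det] eq_matI) auto

lemma mdet_transpose:
  assumes "length xs = length ys"
  shows "mdet F xs ys = mdet (\<lambda>y x. F x y) ys xs"
proof -
  let ?A = "mat (length xs) (length ys) (\<lambda>(i, j). F (xs ! i) (ys ! j))"
  have "det (transpose_mat ?A) = det ?A"
    by (rule det_transpose[of _ "length xs"]) (use assms in simp)
  moreover have "transpose_mat ?A = mat (length ys) (length xs) (\<lambda>(i, j). F (xs ! j) (ys ! i))"
    by (intro eq_matI) auto
  ultimately show ?thesis unfolding mdet_def by simp
qed

lemma mdet_swap: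
  assumes "length (pre @ x # y # zs) = length ys"
  shows "mdet F (pre @ x # y # zs) ys = - mdet F (pre @ y # x # zs) ys"
proof -
  let ?n = "length ys" and ?k = "length pre"
  let ?A = "\<lambda>xs. mat (length xs) (length ys) (\<lambda>(i, j). F (xs ! i) (ys ! j))"
  have eq: "?A (pre @ x # y # zs) = swaprows ?k (Suc ?k) (?A (pre @ y # x # zs))"
    using assms by (intro eq_matI) (auto simp: nth_append nth_Cons' mat_swaprows_def)
  show ?thesis unfolding mdet_def eq
    by (rule det_swaprows[of _ ?n]) (use assms in auto)
qed

lemma mdet_scale_rows:
  assumes "length xs = length ys"
  shows "mdet (\<lambda>x y. c x * F x y) xs ys = prod_list (map c xs) * mdet F xs ys"
proof -
  let ?n = "length ys"
  let ?A = "mat ?n ?n (\<lambda>(i, j). F (xs ! i) (ys ! j))"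
  let ?P = "mat ?n ?n (\<lambda>(i, j). if i = j then c (xs ! i) else 0)"
  have "mat ?n ?n (\<lambda>(i, j). c (xs ! i) * F (xs ! i) (ys ! j)) = ?P * ?A"
    using assms by (intro eq_matI) (simp_all add: scalar_prod_def if_distrib[of "\<lambda>z. z * _"] cong: if_cong)
  moreover have "det (?P * ?A) = det ?P * det ?A"
    by (rule det_mult) auto
  moreover have "det ?P = prod_list (diag_mat ?P)"
    by (rule det_upper_triangular) auto
  moreover have "diag_mat ?P = map c xs"
    using assms by (intro nth_equalityI) (auto simp: diag_mat_def)
  ultimately show ?thesis unfolding mdet_def using assms by simp
qed

lemma mdet_scale:
  assumes "length xs = length ys"
  shows "mdet (\<lambda>x y. c x * F x y * d y) xs ys
    = prod_list (map c xs) * prod_list (map d ys) * mdet F xs ys"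
proof -
  have "mdet (\<lambda>x y. c x * (F x y * d y)) xs ys = prod_list (map c xs) * mdet (\<lambda>x y. F x y * d y) xs ys"
    by (rule mdet_scale_rows) (rule assms)
  also have "mdet (\<lambda>x y. F x y * d y) xs ys = mdet (\<lambda>y x. d y * F x y) ys xs"
    by (subst mdet_transpose[OF assms]) (simp add: mult.commute)
  also have "\<dots> = prod_list (map d ys) * mdet F xs ys"
    by (subst mdet_scale_rows) (use assms in \<open>simp_all add: mdet_transpose[OF assms]\<close>)
  finally show ?thesis by (simp add: mult.assoc)
qed

text \<open>Left multiplication by a lower triangular matrix with unit diagonal, whose other nonzero
  entries lie in the first column. The condition \<open>c t = 0\<close> keeps row \<open>t\<close>
  unchanged, so that one formula covers all labels.\<close>

lemma mdet_add_rows: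
  assumes "length (t # xs) = length ys" "t \<notin> set xs" "c t = 0"
  shows "mdet (\<lambda>x y. F x y - c x * F t y) (t # xs) ys = mdet F (t # xs) ys"
proof -
  let ?n = "length ys"
  let ?A = "mat ?n ?n (\<lambda>(i, j). F ((t # xs) ! i) (ys ! j))"
  let ?P = "mat ?n ?n (\<lambda>(i, j). if i = j then 1 else if j = 0 then - c ((t # xs) ! i) else 0)"
  have "mat ?n ?n (\<lambda>(i, j). F ((t # xs) ! i) (ys ! j) - c ((t # xs) ! i) * F t (ys ! j)) = ?P * ?A"
  proof (intro eq_matI)
    fix i j assume "i < dim_row (?P * ?A)" "j < dim_col (?P * ?A)"
    then have i: "i < ?n" and j: "j < ?n" by auto
    have "(?P * ?A) $$ (i, j)
      = (\<Sum>k\<in>{0..<?n}. (if i = k then 1 else if k = 0 then - c ((t # xs) ! i) else 0) * F ((t # xs) ! k) (ys ! j))"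
      using i j by (simp add: scalar_prod_def)
    \<comment> \<open>For \<open>i = 0\<close> both deltas sit at \<open>k = 0\<close>; the surplus
      term carries the factor \<open>c t = 0\<close>.\<close>
    also have "\<dots> = (\<Sum>k\<in>{0..<?n}. (if i = k then F ((t # xs) ! k) (ys ! j) else 0)
        + (if k = 0 then - c ((t # xs) ! i) * F ((t # xs) ! k) (ys ! j) else 0))"
      using assms(3) by (intro sum.cong) auto
    also have "\<dots> = F ((t # xs) ! i) (ys ! j) - c ((t # xs) ! i) * F t (ys ! j)"
      using i by (cases "ys = []") (simp_all add: sum.distrib)
    finally show "mat ?n ?n (\<lambda>(i, j). F ((t # xs) ! i) (ys ! j) - c ((t # xs) ! i) * F t (ys ! j)) $$ (i, j)
      = (?P * ?A) $$ (i, j)" using i j by simp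
  qed auto
  moreover have "det (?P * ?A) = det ?P * det ?A"
    by (rule det_mult) auto
  moreover have "det ?P = prod_list (diag_mat ?P)"
    by (rule det_lower_triangular[of ?n]) auto
  moreover have "diag_mat ?P = replicate ?n 1"
    by (intro nth_equalityI) (auto simp: diag_mat_def)
  ultimately show ?thesis unfolding mdet_def using assms by simp
qed

lemma mdet_pivot_column:
  assumes "length xs = length ys" "\<And>x. x \<in> set xs \<Longrightarrow> F x y0 = 0"
  shows "mdet F (x0 # xs) (y0 # ys) = F x0 y0 * mdet F xs ys"
proof -
  let ?n = "length ys"
  let ?A1 = "mat 1 1 (\<lambda>_. F x0 y0)" and ?A2 = "mat 1 ?n (\<lambda>(i, j). F x0 (ys ! j))"
  let ?A4 = "mat ?n ?n (\<lambda>(i, j). F (xs ! i) (ys ! j))"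
  have "det (four_block_mat ?A1 ?A2 (0\<^sub>m ?n 1) ?A4) = det ?A1 * det ?A4"
    by (rule det_four_block_mat_lower_left_zero_col) auto
  moreover have "four_block_mat ?A1 ?A2 (0\<^sub>m ?n 1) ?A4
    = mat (Suc ?n) (Suc ?n) (\<lambda>(i, j). F ((x0 # xs) ! i) ((y0 # ys) ! j))"
    using assms by (intro eq_matI) (auto simp: nth_Cons')
  moreover have "det ?A1 = F x0 y0" by (subst det_single) auto
  ultimately show ?thesis unfolding mdet_def using assms by simp
qed

lemma mdet_pivot_row:
  assumes "length xs = length ys" "\<And>y. y \<in> set ys \<Longrightarrow> F x0 y = 0"
  shows "mdet F (x0 # xs) (y0 # ys) = F x0 y0 * mdet F xs ys"
proof -
  have "mdet F (x0 # xs) (y0 # ys) = mdet (\<lambda>y x. F x y) (y0 # ys) (x0 # xs)"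
    by (rule mdet_transpose) (use assms in simp)
  also have "\<dots> = F x0 y0 * mdet (\<lambda>y x. F x y) ys xs"
    by (rule mdet_pivot_column) (use assms in simp_all)
  also have "mdet (\<lambda>y x. F x y) ys xs = mdet F xs ys"
    by (rule mdet_transpose[symmetric]) (rule assms)
  finally show ?thesis .
qed

lemma mdet_Schur:
  assumes "length xs = length ys" "t \<notin> set xs" "F t t = 1"
  shows "mdet F (t # xs) (t # ys) = mdet (\<lambda>x y. F x y - F x t * F t y) xs ys"
proof -
  \<comment> \<open>\<open>?c\<close> is \<open>F x t\<close> with the value at \<open>t\<close>
    reset to 0, as the row operation requires; on \<open>xs\<close> nothing changes, since
    \<open>t\<close> does not occur there.\<close>
  let ?c = "\<lambda>x. if x = t then 0 else F x t"
  have "mdet F (t # xs) (t # ys) = mdet (\<lambda>x y. F x y - ?c x * F t y) (t # xs) (t # ys)"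
    by (rule mdet_add_rows[symmetric]) (use assms in auto)
  also have "\<dots> = mdet (\<lambda>x y. F x y - ?c x * F t y) xs ys"
    by (subst mdet_pivot_column) (use assms in auto)
  also have "\<dots> = mdet (\<lambda>x y. F x y - F x t * F t y) xs ys"
    by (rule mdet_cong) (use assms in auto)
  finally show ?thesis .
qed

section \<open>Minors indexed by sets\<close>

text \<open>Equal arguments give -1, an arbitrary choice that lets the square be 1 without a side
  condition.\<close>

definition osgn :: "'b::linorder \<Rightarrow> 'b \<Rightarrow> int" where
  "osgn x y = (if x < y then 1 else - 1)"

fun invs :: "'b::linorder list \<Rightarrow> int" where
  "invs [] = 1"
| "invs (x # xs) = prod_list (map (osgn x) xs) * invs xs"

lemma osgn_sq [simp]: "osgn x y * osgn x y = 1"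
  by (auto simp: osgn_def)

lemma osgn_commute: "x \<noteq> y \<Longrightarrow> osgn x y = - osgn y x"
  by (auto simp: osgn_def)

lemma invs_swap: "x \<noteq> y \<Longrightarrow> invs (pre @ x # y # zs) = - invs (pre @ y # x # zs)"
  by (induction pre) (simp_all add: osgn_commute[of x y] algebra_simps)

lemma invs_sorted: "sorted_wrt (<) xs \<Longrightarrow> invs xs = 1"
proof (induction xs)
  case (Cons x xs)
  then have "map (osgn x) xs = replicate (length xs) 1"
    by (intro nth_equalityI) (auto simp: osgn_def)
  then show ?case using Cons by simp
qed simp

text \<open>The factor \<open>invs\<close> is the sign of the sorting permutation, so \<open>sdet F xs ys\<close> depends only on the
  sets of labels.\<close>

definition sdet :: "('i::linorder \<Rightarrow> 'i \<Rightarrow> 'a::comm_ring_1) \<Rightarrow> 'i list \<Rightarrow> 'i list \<Rightarrow> 'a" where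
  "sdet F xs ys = of_int (invs xs * invs ys) * mdet F xs ys"

lemma sdet_transpose:
  "length xs = length ys \<Longrightarrow> sdet F xs ys = sdet (\<lambda>y x. F x y) ys xs"
  unfolding sdet_def by (subst mdet_transpose) (auto simp: mult.commute)

text \<open>A rearrangement is a composition of exchanges of two leading elements under common
  prefixes, so invariance under permutations reduces to one adjacent swap. The auxiliary fact
  \<open>front\<close> carries an element to the front by such swaps.\<close>

lemma mset_eq_induct_swap [consumes 1, case_names refl swap cons trans]:
  assumes "mset xs = mset ys"
    and "\<And>xs. P xs xs"
    and "\<And>x y zs. P (x # y # zs) (y # x # zs)"
    and "\<And>x xs ys. mset xs = mset ys \<Longrightarrow> P xs ys \<Longrightarrow> P (x # xs) (x # ys)"
    and "\<And>xs ys zs. mset xs = mset ys \<Longrightarrow> mset ys = mset zs \<Longrightarrow> P xs ys \<Longrightarrow> P ys zs \<Longrightarrow> P xs zs"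
  shows "P xs ys"
proof -
  have front: "P (as @ x # bs) (x # as @ bs)" for as bs :: "'a list" and x
  proof (induction as)
    case (Cons a as)
    then have "P (a # as @ x # bs) (a # x # as @ bs)" by (intro assms(4)) auto
    then have "P (a # as @ x # bs) (x # a # as @ bs)"
      by (rule assms(5)[rotated 2]) (auto intro: assms(3))
    then show ?case by simp
  qed (simp add: assms(2))
  show ?thesis using assms(1)
  proof (induction ys arbitrary: xs)
    case (Cons y ys)
    then have "y \<in> set xs" by (metis list.set_intros(1) mset_eq_setD)
    then obtain as bs where xs: "xs = as @ y # bs" by (meson split_list)
    with Cons have m: "mset (as @ bs) = mset ys" by simp
    have "P (y # as @ bs) (y # ys)" using m Cons.IH[OF m] by (rule assms(4))
    with front[of as y bs] show ?case unfolding xs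
      by (rule assms(5)[rotated 2]) (use m in auto)
  qed (simp add: assms(2))
qed

lemma sdet_perm_rows:
  assumes "mset xs = mset xs'" "distinct xs" "length xs = length ys"
  shows "sdet F xs ys = sdet F xs' ys"
proof -
  \<comment> \<open>A prefix \<open>pre\<close> is carried along because the \<open>cons\<close>
    case strips a common first element, whereas both signs refer to the full list. In the swap case
    \<open>mdet\<close> and \<open>invs\<close> change sign together.\<close>
  have "distinct (pre @ xs) \<and> length (pre @ xs) = length ys \<longrightarrow> sdet F (pre @ xs) ys = sdet F (pre @ xs') ys" for pre
    using assms(1)
  proof (induction xs xs' arbitrary: pre rule: mset_eq_induct_swap)
    case (swap x y zs)
    show ?case
      by (auto simp: sdet_def mdet_swap[of pre x y zs] invs_swap[of x y pre zs])
  next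
    case (cons x xs ys)
    from cons(2)[of "pre @ [x]"] show ?case by simp
  next
    case (trans xs ys zs)
    then show ?case by (metis distinct_append mset_eq_imp_distinct_iff mset_eq_setD mset_eq_length length_append)
  qed auto
  from this[of "[]"] show ?thesis using assms by simp
qed

lemma sdet_set_eq:
  assumes "set xs = set xs'" "set ys = set ys'" "distinct xs" "distinct xs'" "distinct ys" "distinct ys'"
    and "length xs = length ys"
  shows "sdet F xs ys = sdet F xs' ys'"
proof -
  have m: "mset xs = mset xs'" "mset ys = mset ys'" using assms set_eq_iff_mset_eq_distinct by blast+
  have l: "length xs' = length ys" "length ys' = length xs'" 
    using assms(7) m by (auto dest!: mset_eq_length)
  have "sdet F xs ys = sdet F xs' ys" by (rule sdet_perm_rows) (use m assms in auto)
  also have "\<dots> = sdet (\<lambda>y x. F x y) ys xs'" by (rule sdet_transpose) (use l in auto)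
  also have "\<dots> = sdet (\<lambda>y x. F x y) ys' xs'" by (rule sdet_perm_rows) (use m l assms in auto)
  also have "\<dots> = sdet F xs' ys'" by (rule sdet_transpose) (use l in auto)
  finally show ?thesis .
qed

lemma prod_list_osgn_sq: "prod_list (map (osgn t) xs) * prod_list (map (osgn t) xs) = 1"
proof (induction xs)
  case (Cons x xs)
  have "prod_list (map (osgn t) (x # xs)) * prod_list (map (osgn t) (x # xs))
    = (osgn t x * osgn t x) * (prod_list (map (osgn t) xs) * prod_list (map (osgn t) xs))"
    by (simp only: list.map prod_list.Cons ac_simps)
  then show ?case using Cons by simp
qed simp

lemma invs_sq: "invs xs * invs xs = 1"
proof (induction xs)
  case (Cons x xs)
  have "invs (x # xs) * invs (x # xs)
    = (prod_list (map (osgn x) xs) * prod_list (map (osgn x) xs)) * (invs xs * invs xs)"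
    by (simp only: invs.simps ac_simps)
  then show ?case using Cons by (simp add: prod_list_osgn_sq)
qed simp

lemma mdet_simultaneous_perm:
  fixes F :: "'i::linorder \<Rightarrow> 'i \<Rightarrow> 'a::comm_ring_1"
  assumes "set xs = set ys" "distinct xs" "distinct ys"
  shows "mdet F xs xs = mdet F ys ys"
proof -
  have "sdet F xs xs = sdet F ys ys" by (rule sdet_set_eq) (use assms in auto)
  then show ?thesis by (simp add: sdet_def invs_sq)
qed

lemma mdet_peel_columns:
  assumes "\<And>i. i \<in> set us \<Longrightarrow> F i i = 1" "sorted_wrt (\<lambda>i x. F x i = 0) us"
    and "\<And>i x. i \<in> set us \<Longrightarrow> x \<in> set xs \<Longrightarrow> F x i = 0"
  shows "mdet F (us @ xs) (us @ xs) = mdet F xs xs"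
  using assms
proof (induction us)
  case (Cons u us)
  have "mdet F ((u # us) @ xs) ((u # us) @ xs) = F u u * mdet F (us @ xs) (us @ xs)"
    unfolding append_Cons by (rule mdet_pivot_column) (use Cons.prems in auto)
  then show ?case using Cons by simp
qed simp

lemma mdet_peel_rows:
  assumes "\<And>i. i \<in> set us \<Longrightarrow> F i i = 1" "sorted_wrt (\<lambda>i y. F i y = 0) us"
    and "\<And>i y. i \<in> set us \<Longrightarrow> y \<in> set xs \<Longrightarrow> F i y = 0"
  shows "mdet F (us @ xs) (us @ xs) = mdet F xs xs"
  using assms
proof (induction us)
  case (Cons u us)
  have "mdet F ((u # us) @ xs) ((u # us) @ xs) = F u u * mdet F (us @ xs) (us @ xs)"
    unfolding append_Cons by (rule mdet_pivot_row) (use Cons.prems in auto)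
  then show ?case using Cons by simp
qed simp

text \<open>This removes the indices of empty columns. Those below \<open>l\<close> have a column
  that vanishes under the diagonal, those from \<open>m\<close> on a row that vanishes left of it;
  with diagonal entry 1 both kinds peel off as pivots.\<close>

lemma mdet_drop_unit_indices:
  fixes F :: "nat \<Rightarrow> nat \<Rightarrow> 'a::comm_ring_1"
  assumes lm: "m0 \<le> l" "l \<le> m" "m \<le> n"
    and diag: "\<And>i. i \<in> {m0..<l} \<union> {m..<n} \<Longrightarrow> F i i = 1"
    and col: "\<And>i x. i \<in> {m0..<l} \<Longrightarrow> i < x \<Longrightarrow> F x i = 0"
    and row: "\<And>i y. i \<in> {m..<n} \<Longrightarrow> m0 \<le> y \<Longrightarrow> y < i \<Longrightarrow> F i y = 0"
  shows "mdet F [m0..<n] [m0..<n] = mdet F [l..<m] [l..<m]"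
proof -
  \<comment> \<open>The upper indices go to the front in decreasing order: then the row of each
    vanishes on every label that follows.\<close>
  have "mdet F [m0..<n] [m0..<n] = mdet F (rev [m..<n] @ [m0..<m]) (rev [m..<n] @ [m0..<m])"
    by (rule mdet_simultaneous_perm) (use lm in auto)
  also have "\<dots> = mdet F [m0..<m] [m0..<m]"
  proof (rule mdet_peel_rows)
    have "sorted_wrt (\<lambda>x y. F y x = 0) [m..<n]"
      by (rule sorted_wrt_mono_rel[OF _ sorted_wrt_upt]) (use row lm in auto)
    then show "sorted_wrt (\<lambda>i y. F i y = 0) (rev [m..<n])" by (simp add: sorted_wrt_rev)
  qed (use diag row in auto)
  also have "[m0..<m] = [m0..<l] @ [l..<m]" using lm upt_add_eq_append[of m0 l "m - l"] by simp
  also have "mdet F ([m0..<l] @ [l..<m]) ([m0..<l] @ [l..<m]) = mdet F [l..<m] [l..<m]"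
  proof (rule mdet_peel_columns)
    show "sorted_wrt (\<lambda>i x. F x i = 0) [m0..<l]"
      by (rule sorted_wrt_mono_rel[OF _ sorted_wrt_upt]) (use col in auto)
  qed (use diag col in auto)
  finally show ?thesis .
qed

section \<open>Flips of unitriangular matrices\<close>

text \<open>These are the conventions of the theorem: with \<open>l\<close> one above the last
  content, \<open>R p p\<close> belongs to the empty ribbon and \<open>R p l\<close> with
  \<open>l < p\<close> to an undefined one.\<close>

definition unitri :: "('i::linorder \<Rightarrow> 'i \<Rightarrow> 'a::comm_ring_1) \<Rightarrow> bool" where
  "unitri R \<longleftrightarrow> (\<forall>p. R p p = 1) \<and> (\<forall>p l. l < p \<longrightarrow> R p l = 0)"

text \<open>If \<open>R p l\<close> is the ribbon function of the contents \<open>p, \<dots>, l - 1\<close>, then \<open>flip t R\<close> belongs to the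
  cutting strip whose step from \<open>t - 1\<close> to \<open>t\<close> has been turned from up to right (or back): the product
  of two ribbon functions is the sum of those for the two ways of gluing the ribbons.\<close>

definition flip :: "'i::linorder \<Rightarrow> ('i \<Rightarrow> 'i \<Rightarrow> 'a::comm_ring_1) \<Rightarrow> 'i \<Rightarrow> 'i \<Rightarrow> 'a" where
  "flip t R p l = (if p < t \<and> t < l then R p t * R t l - R p l else R p l)"

lemma unitri_flip: "unitri R \<Longrightarrow> unitri (flip t R)"
  by (auto simp: unitri_def flip_def)

text \<open>The entries \<open>R p t\<close> and \<open>R t l\<close> end at \<open>t\<close> and
  are not altered by the flip, so subtracting from their product twice restores
  \<open>R p l\<close>.\<close>

lemma flip_flip [simp]: "flip t (flip t R) = R"
  by (auto simp: flip_def fun_eq_iff)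

lemma of_int_prod_list: "of_int (prod_list xs) = prod_list (map of_int xs)"
  by (induction xs) auto

text \<open>The Schur complement at \<open>t\<close> is \<open>- flip t R x y\<close> for
  \<open>x < t < y\<close>; otherwise unitriangularity kills the product and leaves
  \<open>R x y\<close>. So the two differ by the signs \<open>osgn t x * osgn t y\<close>, the case
  \<open>y < t < x\<close> being harmless because the entry is 0. Putting \<open>t\<close> in front
  of both lists changes \<open>invs\<close> by exactly these signs.\<close>

lemma sdet_flip_outside:
  fixes R :: "'i::linorder \<Rightarrow> 'i \<Rightarrow> 'a::comm_ring_1"
  assumes R: "unitri R" and t: "t \<notin> set ps" "t \<notin> set ls" and len: "length ps = length ls"
  shows "sdet (flip t R) ps ls = sdet R (t # ps) (t # ls)"
proof -
  let ?s = "\<lambda>x. of_int (osgn t x) :: 'a"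
  have "mdet R (t # ps) (t # ls) = mdet (\<lambda>x y. R x y - R x t * R t y) ps ls"
    by (rule mdet_Schur) (use assms in \<open>auto simp: unitri_def\<close>)
  also have "\<dots> = mdet (\<lambda>x y. ?s x * flip t R x y * ?s y) ps ls"
  proof (rule mdet_cong)
    fix x y assume "x \<in> set ps" "y \<in> set ls"
    with t have "x \<noteq> t" "y \<noteq> t" by auto
    then show "R x y - R x t * R t y = ?s x * flip t R x y * ?s y"
      using R by (auto simp: unitri_def flip_def osgn_def not_less)
  qed
  also have "\<dots> = prod_list (map ?s ps) * prod_list (map ?s ls) * mdet (flip t R) ps ls"
    by (rule mdet_scale) (rule len)
  also have "\<dots> = of_int (prod_list (map (osgn t) ps) * prod_list (map (osgn t) ls)) * mdet (flip t R) ps ls"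
    by (simp add: of_int_prod_list comp_def)
  finally have eq: "mdet R (t # ps) (t # ls) = \<dots>" .
  have "(prod_list (map (osgn t) ps) * invs ps * (prod_list (map (osgn t) ls) * invs ls)) *
     (prod_list (map (osgn t) ps) * prod_list (map (osgn t) ls))
    = (prod_list (map (osgn t) ps) * prod_list (map (osgn t) ps)) * 
      (prod_list (map (osgn t) ls) * prod_list (map (osgn t) ls)) * (invs ps * invs ls)"
    by (simp only: ac_simps)
  also have "\<dots> = invs ps * invs ls" by (simp add: prod_list_osgn_sq)
  finally show ?thesis unfolding sdet_def eq invs.simps
    by (simp only: mult.assoc[symmetric] of_int_mult[symmetric])
qed

lemma prod_list_sign_card:
  assumes "distinct xs"
  shows "prod_list (map (\<lambda>x. if P x then - 1 else 1) xs) = ((- 1) ^ card {x \<in> set xs. P x} :: 'a::comm_ring_1)"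
  using assms
proof (induction xs)
  case (Cons x xs)
  have "{y \<in> set (x # xs). P y} = (if P x then insert x {y \<in> set xs. P y} else {y \<in> set xs. P y})"
    by auto
  then show ?case using Cons by simp
qed simp

lemma sign_move:
  fixes x y :: "'a::comm_ring_1"
  assumes "x = (- 1) ^ n * y"
  shows "y = (- 1) ^ n * x"
  unfolding assms by (simp only: left_minus_one_mult_self)

text \<open>Subtracting \<open>R x t\<close> times row \<open>t\<close> yields the flipped entries,
  with sign -1 exactly for \<open>x < t < y\<close>. Row signs for \<open>x < t\<close> and column
  signs for \<open>y < t\<close> reproduce this: they cancel when both apply, and a column sign
  alone only meets entries that are 0.\<close>

lemma sdet_flip_row:
  fixes R :: "'i::linorder \<Rightarrow> 'i \<Rightarrow> 'a::comm_ring_1"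
  assumes R: "unitri R" and t: "t \<in> set ps" "t \<notin> set ls" and len: "length ps = length ls"
    and dist: "distinct ps" "distinct ls"
  shows "sdet (flip t R) ps ls = (- 1) ^ (card {p \<in> set ps. p < t} + card {l \<in> set ls. l \<le> t}) * sdet R ps ls"
proof -
  obtain qs where qs: "mset ps = mset (t # qs)"
    using t(1) by (metis in_set_conv_decomp mset.simps(2) mset_append union_mset_add_mset_right)
  have dq: "distinct (t # qs)" using dist(1) mset_eq_imp_distinct_iff[OF qs] by blast
  have lq: "length (t # qs) = length ls" using mset_eq_length[OF qs] len by simp
  have sq: "set ps = set (t # qs)" using mset_eq_setD[OF qs] .
  let ?s = "\<lambda>x. if x < t then - 1 else 1 :: 'a" and ?s' = "\<lambda>x. if x \<le> t then - 1 else 1 :: 'a"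
  let ?c = "\<lambda>x. if x = t then 0 else R x t"
  have "mdet R (t # qs) ls = mdet (\<lambda>x y. R x y - ?c x * R t y) (t # qs) ls"
    by (rule mdet_add_rows[symmetric]) (use lq dq in auto)
  also have "\<dots> = mdet (\<lambda>x y. ?s x * flip t R x y * ?s' y) (t # qs) ls"
  proof (rule mdet_cong)
    fix x y assume "y \<in> set ls"
    with t have "y \<noteq> t" by auto
    then show "R x y - ?c x * R t y = ?s x * flip t R x y * ?s' y"
      using R by (auto simp: unitri_def flip_def not_less not_le)
  qed
  also have "\<dots> = prod_list (map ?s (t # qs)) * prod_list (map ?s' ls) * mdet (flip t R) (t # qs) ls"
    by (rule mdet_scale) (rule lq)
  also have "\<dots> = (- 1) ^ (card {p \<in> set ps. p < t} + card {l \<in> set ls. l \<le> t}) * mdet (flip t R) (t # qs) ls"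
    unfolding prod_list_sign_card[OF dq] prod_list_sign_card[OF dist(2)] sq power_add ..
  finally have "sdet R (t # qs) ls = (- 1) ^ (card {p \<in> set ps. p < t} + card {l \<in> set ls. l \<le> t}) * sdet (flip t R) (t # qs) ls"
    unfolding sdet_def by (simp add: ac_simps)
  then show ?thesis
    unfolding sdet_perm_rows[OF qs dist(1) len] by (rule sign_move)
qed

text \<open>Now \<open>t\<close> labels a column, whose entries the flip must keep. The rows
  \<open>x < t\<close> carry the sign -1, and the non-strict \<open>l \<le> t\<close> lets column
  \<open>t\<close> carry it too; its entries in rows \<open>x > t\<close> are 0.\<close>

lemma sdet_flip_col:
  fixes R :: "'i::linorder \<Rightarrow> 'i \<Rightarrow> 'a::comm_ring_1"
  assumes R: "unitri R" and t: "t \<notin> set ps" "t \<in> set ls" and len: "length ps = length ls"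
    and dist: "distinct ps" "distinct ls"
  shows "sdet (flip t R) ps ls = (- 1) ^ (card {p \<in> set ps. p < t} + card {l \<in> set ls. l \<le> t}) * sdet R ps ls"
proof -
  obtain qs where qs: "mset ls = mset (t # qs)"
    using t(2) by (metis in_set_conv_decomp mset.simps(2) mset_append union_mset_add_mset_right)
  have dq: "distinct (t # qs)" using dist(2) mset_eq_imp_distinct_iff[OF qs] by blast
  have lq: "length (t # qs) = length ps" using mset_eq_length[OF qs] len by simp
  have sq: "set ls = set (t # qs)" using mset_eq_setD[OF qs] .
  let ?s = "\<lambda>x. if x < t then - 1 else 1 :: 'a" and ?s' = "\<lambda>x. if x \<le> t then - 1 else 1 :: 'a"
  let ?c = "\<lambda>y. if y = t then 0 else R t y"
  have "mdet (\<lambda>y x. R x y) (t # qs) ps = mdet (\<lambda>y x. R x y - ?c y * R x t) (t # qs) ps"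
    by (rule mdet_add_rows[symmetric]) (use lq dq in auto)
  also have "\<dots> = mdet (\<lambda>y x. ?s' y * flip t R x y * ?s x) (t # qs) ps"
  proof (rule mdet_cong)
    fix x y assume "x \<in> set ps"
    with t have "x \<noteq> t" by auto
    then show "R x y - ?c y * R x t = ?s' y * flip t R x y * ?s x"
      using R by (auto simp: unitri_def flip_def not_less not_le)
  qed
  also have "\<dots> = prod_list (map ?s' (t # qs)) * prod_list (map ?s ps) * mdet (\<lambda>y x. flip t R x y) (t # qs) ps"
    by (rule mdet_scale) (rule lq)
  also have "\<dots> = (- 1) ^ (card {p \<in> set ps. p < t} + card {l \<in> set ls. l \<le> t}) * mdet (\<lambda>y x. flip t R x y) (t # qs) ps"
    unfolding prod_list_sign_card[OF dq] prod_list_sign_card[OF dist(1)] sq power_add by (simp add: ac_simps)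
  finally have "sdet (\<lambda>y x. R x y) (t # qs) ps
      = (- 1) ^ (card {p \<in> set ps. p < t} + card {l \<in> set ls. l \<le> t}) * sdet (\<lambda>y x. flip t R x y) (t # qs) ps"
    unfolding sdet_def by (simp add: ac_simps)
  then have "sdet (\<lambda>y x. R x y) ls ps
      = (- 1) ^ (card {p \<in> set ps. p < t} + card {l \<in> set ls. l \<le> t}) * sdet (\<lambda>y x. flip t R x y) ls ps"
    unfolding sdet_perm_rows[OF qs dist(2) len[symmetric]] .
  then show ?thesis
    unfolding sdet_transpose[OF len] by (rule sign_move)
qed

section \<open>Effect of a sequence of flips on a minor with sorted labels\<close>

definition minor :: "('i::linorder \<Rightarrow> 'i \<Rightarrow> 'a::comm_ring_1) \<Rightarrow> 'i set \<Rightarrow> 'i set \<Rightarrow> 'a" where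
  "minor F X Y = mdet F (sorted_list_of_set X) (sorted_list_of_set Y)"

lemma minor_eq_sdet:
  assumes "distinct xs" "distinct ys" "length xs = length ys"
  shows "minor F (set xs) (set ys) = sdet F xs ys"
proof -
  have "sdet F xs ys = sdet F (sorted_list_of_set (set xs)) (sorted_list_of_set (set ys))"
    by (rule sdet_set_eq) (use assms in auto)
  then show ?thesis unfolding minor_def sdet_def by (simp add: invs_sorted)
qed

lemma minor_conv_sdet:
  assumes "finite X" "finite Y" "card X = card Y"
  shows "minor F X Y = sdet F (sorted_list_of_set X) (sorted_list_of_set Y)"
  using minor_eq_sdet[of "sorted_list_of_set X" "sorted_list_of_set Y" F] assms by simp

lemma minor_flip_outside:
  assumes "unitri R" "finite X" "finite Y" "card X = card Y" "t \<notin> X" "t \<notin> Y"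
  shows "minor (flip t R) X Y = minor R (insert t X) (insert t Y)"
  using minor_eq_sdet[of "t # sorted_list_of_set X" "t # sorted_list_of_set Y" R]
    sdet_flip_outside[of R t "sorted_list_of_set X" "sorted_list_of_set Y"] assms
  by (simp add: minor_conv_sdet)

lemma minor_flip_one:
  assumes "unitri R" "finite X" "finite Y" "card X = card Y" "(t \<in> X) \<noteq> (t \<in> Y)"
  shows "minor (flip t R) X Y = (- 1) ^ (card {p \<in> X. p < t} + card {l \<in> Y. l \<le> t}) * minor R X Y"
  using sdet_flip_row[of R t "sorted_list_of_set X" "sorted_list_of_set Y"]
    sdet_flip_col[of R t "sorted_list_of_set X" "sorted_list_of_set Y"] assms
  by (cases "t \<in> X") (simp_all add: minor_conv_sdet)

text \<open>Both sides are the sizes of \<open>T\<close>, \<open>X - T\<close>, \<open>Y - T\<close>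
  and then \<open>X \<inter> T\<close>, \<open>Y \<inter> T\<close> compared through
  \<open>T\<close>: on either side the total is \<open>card T + card (X - T) + card (Y - T)\<close>.
  For \<open>card X = card Y\<close> this keeps exchanged minors square; applied to the labels below
  some \<open>t\<close> it compares sign counts before and after an exchange.\<close>

lemma card_exchange:
  fixes X Y T :: "'b set"
  assumes "finite X" "finite Y" "finite T"
  shows "card ((X - T) \<union> (T - Y)) + card Y = card ((Y - T) \<union> (T - X)) + card X"
proof -
  have "card ((X - T) \<union> (T - Y)) = card (X - T) + card (T - Y)"
       "card ((Y - T) \<union> (T - X)) = card (Y - T) + card (T - X)"
    using assms by (auto intro!: card_Un_disjoint)
  moreover have "card X = card (X \<inter> T) + card (X - T)" "card Y = card (Y \<inter> T) + card (Y - T)"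
    "card T = card (T \<inter> X) + card (T - X)" "card T = card (T \<inter> Y) + card (T - Y)"
    using assms by (metis card_Int_Diff)+
  ultimately show ?thesis by (simp add: Int_commute)
qed

lemma unitri_flips: "unitri R \<Longrightarrow> unitri (foldr flip ts R)"
  by (induction ts) (auto intro: unitri_flip)

text \<open>A flip at \<open>t\<close> is a Schur complement or a row or column operation, according to whether \<open>t\<close> labels
  a row or a column.  In sorted order only the operations produce a sign.\<close>

lemma minor_flips:
  fixes U :: "'i::linorder \<Rightarrow> 'i \<Rightarrow> 'a::comm_ring_1"
  assumes U: "unitri U" and fin: "finite I" "finite J" "card I = card J" and "distinct ts"
  shows "minor U I J =
    (- 1) ^ (\<Sum>t | t \<in> set ts \<and> (t \<in> I) \<noteq> (t \<in> J). card {i \<in> I. i < t} + card {j \<in> J. j \<le> t})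
    * minor (foldr flip ts U) ((I - set ts) \<union> (set ts - J)) ((J - set ts) \<union> (set ts - I))"
  using \<open>distinct ts\<close>
proof (induction ts)
  case (Cons t ts)
  let ?k = "\<lambda>t. card {i \<in> I. i < t} + card {j \<in> J. j \<le> t}"
  let ?s = "\<lambda>ts. \<Sum>t | t \<in> set ts \<and> (t \<in> I) \<noteq> (t \<in> J). ?k t"
  define R where "R = foldr flip ts U"
  define X where "X = (I - set ts) \<union> (set ts - J)"
  define Y where "Y = (J - set ts) \<union> (set ts - I)"
  have R: "unitri R" unfolding R_def using U by (rule unitri_flips)
  have t: "t \<notin> set ts" using Cons by simp
  have tX: "t \<in> X \<longleftrightarrow> t \<in> I" and tY: "t \<in> Y \<longleftrightarrow> t \<in> J" using t by (auto simp: X_def Y_def)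
  have fXY: "finite X" "finite Y" using fin by (auto simp: X_def Y_def)
  have cXY: "card X = card Y" using card_exchange[of I J "set ts"] fin by (simp add: X_def Y_def)
  have IH: "minor U I J = (- 1) ^ ?s ts * minor R X Y"
    using Cons unfolding R_def X_def Y_def by simp
  have X': "(I - set (t # ts)) \<union> (set (t # ts) - J) = (if t \<in> J then X - {t} else insert t X)"
    and Y': "(J - set (t # ts)) \<union> (set (t # ts) - I) = (if t \<in> I then Y - {t} else insert t Y)"
    using t by (auto simp: X_def Y_def)
  have R': "foldr flip (t # ts) U = flip t R" by (simp add: R_def)
  show ?case unfolding IH X' Y' R'
  proof (cases "(t \<in> I) = (t \<in> J)")
    case True
    then have "{u. u \<in> set (t # ts) \<and> (u \<in> I) \<noteq> (u \<in> J)} = {u. u \<in> set ts \<and> (u \<in> I) \<noteq> (u \<in> J)}"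
      by auto
    moreover have "minor R X Y
      = minor (flip t R) (if t \<in> J then X - {t} else insert t X) (if t \<in> I then Y - {t} else insert t Y)"
    proof (cases "t \<in> I")
      case I: True
      then have "minor (flip t R) (X - {t}) (Y - {t}) = minor R (insert t (X - {t})) (insert t (Y - {t}))"
        using True R fXY cXY tX tY by (intro minor_flip_outside) auto
      moreover have "insert t (X - {t}) = X" "insert t (Y - {t}) = Y"
        using I True tX tY by auto
      ultimately show ?thesis using I True by simp
    next
      case I: False
      \<comment> \<open>With \<open>t\<close> in neither set the Schur step is read backwards: it is
        applied to \<open>flip t R\<close>, whose flip is \<open>R\<close>.\<close>
      then have "minor (flip t (flip t R)) X Y = minor (flip t R) (insert t X) (insert t Y)"
        using True R fXY cXY tX tY by (intro minor_flip_outside unitri_flip) auto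
      then show ?thesis using I True by simp
    qed
    ultimately show "(- 1) ^ ?s ts * minor R X Y = (- 1) ^ ?s (t # ts) *
       minor (flip t R) (if t \<in> J then X - {t} else insert t X) (if t \<in> I then Y - {t} else insert t Y)"
      by simp
  next
    case False
    then have "{u. u \<in> set (t # ts) \<and> (u \<in> I) \<noteq> (u \<in> J)} = insert t {u. u \<in> set ts \<and> (u \<in> I) \<noteq> (u \<in> J)}"
      by auto
    then have s: "?s (t # ts) = ?k t + ?s ts" using t by simp
    have XY: "(if t \<in> J then X - {t} else insert t X) = X" "(if t \<in> I then Y - {t} else insert t Y) = Y"
      using False tX tY by auto
    \<comment> \<open>The flip produces a sign counted in the current sets \<open>X\<close> and
      \<open>Y\<close>, while the claim counts in \<open>I\<close> and \<open>J\<close>. The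
      exchange identity for the labels below \<open>t\<close> relates the two.\<close>
    have 1: "card {p \<in> X. p < t} + card {j \<in> J. j < t} = card {l \<in> Y. l < t} + card {i \<in> I. i < t}"
    proof -
      have "{p \<in> X. p < t} = ({i \<in> I. i < t} - {u \<in> set ts. u < t}) \<union> ({u \<in> set ts. u < t} - {j \<in> J. j < t})"
        "{p \<in> Y. p < t} = ({i \<in> J. i < t} - {u \<in> set ts. u < t}) \<union> ({u \<in> set ts. u < t} - {j \<in> I. j < t})"
        by (auto simp: X_def Y_def)
      then show ?thesis using card_exchange[of "{i \<in> I. i < t}" "{j \<in> J. j < t}" "{u \<in> set ts. u < t}"] fin
        by simp
    qed
    have 2: "card {l \<in> Y. l \<le> t} = card {l \<in> Y. l < t} + (if t \<in> J then 1 else 0)"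
      "card {l \<in> J. l \<le> t} = card {l \<in> J. l < t} + (if t \<in> J then 1 else 0)"
    proof -
      have "{l \<in> Y. l \<le> t} = (if t \<in> J then insert t {l \<in> Y. l < t} else {l \<in> Y. l < t})"
        "{l \<in> J. l \<le> t} = (if t \<in> J then insert t {l \<in> J. l < t} else {l \<in> J. l < t})"
        using tY by (auto simp: le_less)
      then show "card {l \<in> Y. l \<le> t} = card {l \<in> Y. l < t} + (if t \<in> J then 1 else 0)"
      "card {l \<in> J. l \<le> t} = card {l \<in> J. l < t} + (if t \<in> J then 1 else 0)"
        using fXY fin by simp_all
    qed
    \<comment> \<open>The two exponents add up to twice the number supplied below, so they have the
      same parity; \<open>t\<close> itself contributes equally to both, as it is in \<open>Y\<close>
      iff it is in \<open>J\<close>.\<close>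
    have par: "even u = even v" if "u + v = 2 * m" for u v m :: nat using that by presburger
    have "even (card {p \<in> X. p < t} + card {l \<in> Y. l \<le> t}) = even (?k t)"
      by (rule par[of _ _ "card {l \<in> Y. l < t} + card {i \<in> I. i < t} + (if t \<in> J then 1 else 0)"])
        (use 1 in \<open>simp add: 2\<close>)
    then have "(- 1 :: 'a) ^ (card {p \<in> X. p < t} + card {l \<in> Y. l \<le> t}) = (- 1) ^ ?k t"
      by (simp only: minus_one_power_iff)
    moreover have "minor (flip t R) X Y = (- 1) ^ (card {p \<in> X. p < t} + card {l \<in> Y. l \<le> t}) * minor R X Y"
      using False R fXY cXY tX tY by (intro minor_flip_one) auto
    ultimately show "(- 1) ^ ?s ts * minor R X Y = (- 1) ^ ?s (t # ts) *
       minor (flip t R) (if t \<in> J then X - {t} else insert t X) (if t \<in> I then Y - {t} else insert t Y)"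
      unfolding s XY power_add[of _ "?k t"] by (simp add: mult.assoc mult.left_commute)
  qed
qed simp

text \<open>The entry at \<open>p\<close>, \<open>l\<close> is changed only by flips strictly
  between them, and these refer to the ranges from \<open>p\<close> to \<open>t\<close> and from
  \<open>t\<close> to \<open>l\<close>, which lie inside. Labels outside may be dropped.\<close>

lemma foldr_flip_filter:
  assumes "\<And>t. p < t \<Longrightarrow> t < l \<Longrightarrow> Q t"
  shows "foldr flip (filter Q ts) U p l = foldr flip ts U p l"
  using assms
proof (induction ts arbitrary: p l)
  case (Cons t ts)
  show ?case
  proof (cases "p < t \<and> t < l")
    case True
    then have "foldr flip (filter Q ts) U p t = foldr flip ts U p t"
      "foldr flip (filter Q ts) U t l = foldr flip ts U t l"
      using Cons.prems by (auto intro!: Cons.IH)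
    moreover have "foldr flip (filter Q ts) U p l = foldr flip ts U p l"
      using Cons.prems by (auto intro!: Cons.IH)
    ultimately show ?thesis using True Cons.prems by (simp add: flip_def[of t])
  next
    case False
    moreover have "foldr flip (filter Q ts) U p l = foldr flip ts U p l"
      using Cons.prems by (auto intro!: Cons.IH)
    ultimately show ?thesis by (auto simp: flip_def[of t])
  qed
qed simp

section \<open>The sign of a pairing of heads with tails\<close>

text \<open>The two signs together are a product over unordered pairs. Splitting each exponent as
  \<open>e x y + e y x\<close> gives a sum over ordered pairs, whose order of summation can later be
  exchanged.\<close>

lemma invs_map_eq_power:
  fixes e :: "'b \<Rightarrow> 'b \<Rightarrow> nat" and f g :: "'b \<Rightarrow> 'i::linorder"
  assumes "distinct xs" and "\<And>x. e x x = 0"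
    and "\<And>x y. x \<in> set xs \<Longrightarrow> y \<in> set xs \<Longrightarrow> x \<noteq> y \<Longrightarrow>
      osgn (f x) (f y) * osgn (g x) (g y) = (- 1) ^ (e x y + e y x)"
  shows "invs (map f xs) * invs (map g xs) = (- 1) ^ (\<Sum>x\<in>set xs. \<Sum>y\<in>set xs. e x y)"
  using assms(1,3)
proof (induction xs)
  case (Cons x xs)
  note pair = Cons.prems(2) and dx = Cons.prems(1)
  have *: "prod_list (map (osgn (f x)) (map f ys)) * prod_list (map (osgn (g x)) (map g ys))
      = (- 1) ^ (\<Sum>y\<in>set ys. e x y + e y x)" if "set ys \<subseteq> set xs" "distinct ys" for ys
    using that
  proof (induction ys)
    case (Cons y ys)
    have "osgn (f x) (f y) * osgn (g x) (g y) = (- 1) ^ (e x y + e y x)"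
      using Cons.prems dx by (intro pair) auto
    moreover have "prod_list (map (osgn (f x)) (map f (y # ys))) * prod_list (map (osgn (g x)) (map g (y # ys)))
      = (osgn (f x) (f y) * osgn (g x) (g y)) *
        (prod_list (map (osgn (f x)) (map f ys)) * prod_list (map (osgn (g x)) (map g ys)))"
      by (simp only: list.map prod_list.Cons ac_simps)
    ultimately show ?case using Cons by (simp only:) (simp add: power_add)
  qed simp
  have IH: "invs (map f xs) * invs (map g xs) = (- 1) ^ (\<Sum>x\<in>set xs. \<Sum>y\<in>set xs. e x y)"
    using Cons by simp
  have "invs (map f (x # xs)) * invs (map g (x # xs))
    = (prod_list (map (osgn (f x)) (map f xs)) * prod_list (map (osgn (g x)) (map g xs)))
      * (invs (map f xs) * invs (map g xs))"
    by (simp only: list.map invs.simps ac_simps)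
  also have "\<dots> = (- 1) ^ ((\<Sum>y\<in>set xs. e x y + e y x) + (\<Sum>x\<in>set xs. \<Sum>y\<in>set xs. e x y))"
    unfolding IH using *[of xs] Cons.prems(1) by (simp only: power_add) auto
  also have "(\<Sum>y\<in>set xs. e x y + e y x) + (\<Sum>x\<in>set xs. \<Sum>y\<in>set xs. e x y)
    = (\<Sum>u\<in>set (x # xs). \<Sum>y\<in>set (x # xs). e u y)"
    using Cons.prems(1) assms(2) by (simp add: sum.distrib)
  finally show ?case .
qed simp

text \<open>Think of \<open>x\<close> as a ribbon with contents \<open>f x, \<dots>, g x - 1\<close>.  The sign counts nested pairs of ribbons;
  by \<open>nest\<close> it may be computed from the ends of ribbons in \<open>T\<close> that lie strictly inside other ribbons.\<close>

lemma invs_pairing: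
  fixes f g :: "'b \<Rightarrow> 'i::linorder"
  assumes dist: "distinct xs" and inj: "inj_on f (set xs)" "inj_on g (set xs)"
    and le: "\<And>x. x \<in> set xs \<Longrightarrow> f x \<le> g x"
    and fin: "finite I" "finite J" "finite T" and card: "card I = card J"
    and f: "f ` set xs = (I - T) \<union> (T - J)" and g: "g ` set xs = (J - T) \<union> (T - I)"
    and nest: "\<And>x y. x \<in> set xs \<Longrightarrow> y \<in> set xs \<Longrightarrow> f x < f y \<Longrightarrow> f y < g x \<Longrightarrow>
      f y \<in> T \<longleftrightarrow> (if g x < g y then g x \<in> T else g y \<notin> T)"
  shows "invs (map f xs) * invs (map g xs)
    = (- 1) ^ (\<Sum>t | t \<in> T \<and> (t \<in> I) \<noteq> (t \<in> J). card {i \<in> I. i < t} + card {j \<in> J. j \<le> t})"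
proof -
  let ?S = "set xs"
  define crosses where "crosses = (\<lambda>x t. f x < t \<and> t < g x)"
  define cr where "cr t = (\<Sum>x\<in>?S. of_bool (crosses x t) :: nat)" for t
  define e where "e x y = (of_bool (f y \<in> T \<and> crosses x (f y)) + of_bool (g y \<in> T \<and> crosses x (g y)) :: nat)" for x y
  have "osgn (f x) (f y) * osgn (g x) (g y) = (- 1) ^ (e x y + e y x)"
    if xy: "x \<in> ?S" "y \<in> ?S" "f x < f y" for x y
  proof -
    have ne: "g x \<noteq> g y" using xy inj(2) by (auto dest: inj_onD)
    have le': "f x \<le> g x" "f y \<le> g y" using le xy by auto
    \<comment> \<open>Disjoint, crossing and nested ribbons. Crossing ones have sign 1, and by
      \<open>nest\<close> both or none of the two inner ends are in \<open>T\<close>; nested ones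
      have sign -1, and exactly one end of the inner ribbon is in \<open>T\<close>.\<close>
    consider "g x \<le> f y" | "f y < g x" "g x < g y" | "f y < g x" "g y < g x" using ne by fastforce
    then show ?thesis
    proof cases
      case 1
      then have "e x y = 0" "e y x = 0" "g x < g y"
        using le' xy ne by (auto simp: e_def crosses_def)
      then show ?thesis using xy by (simp add: osgn_def)
    next
      case 2
      then have "e x y = of_bool (f y \<in> T)" "e y x = of_bool (g x \<in> T)"
        using le' xy by (auto simp: e_def crosses_def)
      then show ?thesis using nest[OF xy 2(1)] 2 xy by (simp add: osgn_def)
    next
      case 3
      then have "e x y = of_bool (f y \<in> T) + of_bool (g y \<in> T)" "e y x = 0"
        using le' xy by (auto simp: e_def crosses_def)
      then show ?thesis using nest[OF xy 3(1)] 3 xy by (simp add: osgn_def)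
    qed
  qed note less = this
  have "osgn (f x) (f y) * osgn (g x) (g y) = (- 1) ^ (e x y + e y x)"
    if xy: "x \<in> ?S" "y \<in> ?S" "x \<noteq> y" for x y
  proof -
    have ne: "f x \<noteq> f y" "g x \<noteq> g y" using xy inj by (auto dest: inj_onD)
    show ?thesis
    proof (cases "f x < f y")
      case False
      then have "osgn (f y) (f x) * osgn (g y) (g x) = (- 1) ^ (e y x + e x y)"
        using ne xy by (intro less) auto
      then show ?thesis using osgn_commute[OF ne(1)] osgn_commute[OF ne(2)] by (simp add: add.commute)
    qed (use less xy in auto)
  qed
  then have 1: "invs (map f xs) * invs (map g xs) = (- 1) ^ (\<Sum>x\<in>?S. \<Sum>y\<in>?S. e x y)"
    by (intro invs_map_eq_power dist) (auto simp: e_def crosses_def)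
  have "(\<Sum>x\<in>?S. \<Sum>y\<in>?S. e x y) = (\<Sum>y\<in>?S. \<Sum>x\<in>?S. e x y)"
    by (rule sum.swap)
  also have "\<dots> = (\<Sum>y\<in>?S. of_bool (f y \<in> T) * cr (f y)) + (\<Sum>y\<in>?S. of_bool (g y \<in> T) * cr (g y))"
    unfolding cr_def sum_distrib_left sum.distrib[symmetric] by (intro sum.cong refl) (auto simp: e_def)
  also have "(\<Sum>y\<in>?S. of_bool (f y \<in> T) * cr (f y)) = (\<Sum>t\<in>f ` ?S. of_bool (t \<in> T) * cr t)"
    by (subst sum.reindex[OF inj(1)]) simp
  \<comment> \<open>The head labels that belong to \<open>T\<close> are those in
    \<open>T - J\<close>; likewise the tail labels in \<open>T\<close> form
    \<open>T - I\<close>.\<close>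
  also have "\<dots> = (\<Sum>t\<in>T. of_bool (t \<notin> J) * cr t)"
    unfolding f using fin by (intro sum.mono_neutral_cong) auto
  also have "(\<Sum>y\<in>?S. of_bool (g y \<in> T) * cr (g y)) = (\<Sum>t\<in>g ` ?S. of_bool (t \<in> T) * cr t)"
    by (subst sum.reindex[OF inj(2)]) simp
  also have "\<dots> = (\<Sum>t\<in>T. of_bool (t \<notin> I) * cr t)"
    unfolding g using fin by (intro sum.mono_neutral_cong) auto
  finally have 2: "(\<Sum>x\<in>?S. \<Sum>y\<in>?S. e x y) = (\<Sum>t\<in>T. (of_bool (t \<notin> J) + of_bool (t \<notin> I)) * cr t)"
    by (simp add: sum.distrib algebra_simps)
  \<comment> \<open>The number of ribbons strictly containing \<open>t\<close> is the number
    starting before \<open>t\<close> less the number ending at or before it. The exchange identity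
    below \<open>t\<close> turns these into counts in \<open>I\<close> and \<open>J\<close>, up to
    parity.\<close>
  have parity: "even (cr t) \<longleftrightarrow> even (card {i \<in> I. i < t} + card {j \<in> J. j \<le> t})"
    if t: "t \<in> T" "(t \<in> I) \<noteq> (t \<in> J)" for t
  proof -
    have c1: "card {i \<in> I. i < t} + card {l \<in> g ` ?S. l < t} = card {j \<in> J. j < t} + card {p \<in> f ` ?S. p < t}"
    proof -
      have "{p \<in> f ` ?S. p < t} = ({i \<in> I. i < t} - {u \<in> T. u < t}) \<union> ({u \<in> T. u < t} - {j \<in> J. j < t})"
        "{p \<in> g ` ?S. p < t} = ({i \<in> J. i < t} - {u \<in> T. u < t}) \<union> ({u \<in> T. u < t} - {j \<in> I. j < t})"
        unfolding f g by auto
      then show ?thesis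
        using card_exchange[of "{i \<in> I. i < t}" "{j \<in> J. j < t}" "{u \<in> T. u < t}"] fin by simp
    qed
    have c2: "card {j \<in> J. j \<le> t} = card {j \<in> J. j < t} + of_bool (t \<in> J)"
      "card {l \<in> g ` ?S. l \<le> t} = card {l \<in> g ` ?S. l < t} + of_bool (t \<in> J)"
    proof -
      have "t \<in> g ` ?S \<longleftrightarrow> t \<in> J" unfolding g using t by auto
      then have "{l \<in> g ` ?S. l \<le> t} = (if t \<in> J then insert t {l \<in> g ` ?S. l < t} else {l \<in> g ` ?S. l < t})"
        "{l \<in> J. l \<le> t} = (if t \<in> J then insert t {l \<in> J. l < t} else {l \<in> J. l < t})"
        by (auto simp: le_less)
      then show "card {j \<in> J. j \<le> t} = card {j \<in> J. j < t} + of_bool (t \<in> J)"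
        "card {l \<in> g ` ?S. l \<le> t} = card {l \<in> g ` ?S. l < t} + of_bool (t \<in> J)"
        using fin by simp_all
    qed
    have c3: "cr t + card {l \<in> g ` ?S. l \<le> t} = card {p \<in> f ` ?S. p < t}"
    proof -
      have "{p \<in> f ` ?S. p < t} = f ` {x \<in> ?S. f x < t}" "{l \<in> g ` ?S. l \<le> t} = g ` {x \<in> ?S. g x \<le> t}" by auto
      moreover have "card (f ` {x \<in> ?S. f x < t}) = card {x \<in> ?S. f x < t}"
        "card (g ` {x \<in> ?S. g x \<le> t}) = card {x \<in> ?S. g x \<le> t}"
        using inj by (auto intro!: card_image intro: inj_on_subset)
      moreover have "cr t = card {x \<in> ?S. crosses x t}"
        unfolding cr_def by (simp add: Int_def)
      moreover have "{x \<in> ?S. f x < t} = {x \<in> ?S. crosses x t} \<union> {x \<in> ?S. g x \<le> t}"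
      proof (intro equalityI subsetI)
        fix x assume "x \<in> {x \<in> ?S. crosses x t} \<union> {x \<in> ?S. g x \<le> t}"
        then have x: "x \<in> ?S" "crosses x t \<or> g x \<le> t" by auto
        \<comment> \<open>Otherwise \<open>x\<close> would be an empty range at \<open>t\<close>,
          making \<open>t\<close> both a head and a tail label in \<open>T\<close>; it would then be
          in neither \<open>I\<close> nor \<open>J\<close>.\<close>
        have "f x \<noteq> t" if "g x \<le> t"
        proof
          assume "f x = t"
          then have "g x = t" using that le[OF x(1)] by simp
          have "t \<in> f ` ?S" by (rule image_eqI[of _ _ x]) (simp_all add: \<open>f x = t\<close> x(1))
          moreover have "t \<in> g ` ?S" by (rule image_eqI[of _ _ x]) (simp_all add: \<open>g x = t\<close> x(1))
          ultimately show False using t unfolding f g by auto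
        qed
        then show "x \<in> {x \<in> ?S. f x < t}" using x le[OF x(1)] by (force simp: crosses_def)
      qed (auto simp: crosses_def)
      moreover have "card ({x \<in> ?S. crosses x t} \<union> {x \<in> ?S. g x \<le> t}) = card {x \<in> ?S. crosses x t} + card {x \<in> ?S. g x \<le> t}"
        by (intro card_Un_disjoint) (auto simp: crosses_def)
      ultimately show ?thesis by simp
    qed
    have par: "even (c + (i + j'))" if "i + l = j + p" "j' = j + b" "l' = l + b" "c + l' = p"
      for c i j j' l l' p b :: nat using that by presburger
    have "even (cr t + (card {i \<in> I. i < t} + card {j \<in> J. j \<le> t}))"
      by (rule par[OF c1 c2 c3])
    then show ?thesis by simp
  qed
  have 3: "(- 1 :: int) ^ (\<Sum>t\<in>T. (of_bool (t \<notin> J) + of_bool (t \<notin> I)) * cr t)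
      = (\<Prod>t\<in>T. (- 1) ^ ((of_bool (t \<notin> J) + of_bool (t \<notin> I)) * cr t))"
    by (rule power_sum)
  \<comment> \<open>The weight of \<open>t\<close> is 2 if it is in neither set and 0 if it is in
    both, so only labels in exactly one of them leave a sign.\<close>
  also have "\<dots> = (\<Prod>t\<in>{t \<in> T. (t \<in> I) \<noteq> (t \<in> J)}. (- 1) ^ (card {i \<in> I. i < t} + card {j \<in> J. j \<le> t}))"
  proof (rule prod.mono_neutral_cong_right)
    show "\<forall>t\<in>T - {t \<in> T. (t \<in> I) \<noteq> (t \<in> J)}. (- 1 :: int) ^ ((of_bool (t \<notin> J) + of_bool (t \<notin> I)) * cr t) = 1"
      by (auto simp: power_mult)
    fix t assume "t \<in> {t \<in> T. (t \<in> I) \<noteq> (t \<in> J)}"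
    then have "t \<in> T" "(t \<in> I) \<noteq> (t \<in> J)" by auto
    from parity[OF this] this(2)
    show "(- 1 :: int) ^ ((of_bool (t \<notin> J) + of_bool (t \<notin> I)) * cr t)
      = (- 1) ^ (card {i \<in> I. i < t} + card {j \<in> J. j \<le> t})"
      by (cases "t \<in> I") (simp_all add: minus_one_power_iff)
  qed (use fin in auto)
  also have "\<dots> = (- 1) ^ (\<Sum>t | t \<in> T \<and> (t \<in> I) \<noteq> (t \<in> J). card {i \<in> I. i < t} + card {j \<in> J. j \<le> t})"
    by (rule power_sum[symmetric])
  finally show ?thesis unfolding 1 2 .
qed

section \<open>Sub-ribbons of the cutting strip\<close>

lemma nup_0 [simp]: "nup up p p = 0" and nrt_0 [simp]: "nrt up p p = 0"
  by (simp_all add: nup_def nrt_def)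

lemma atLeastLessThan_plus1: "p \<le> c \<Longrightarrow> {c' \<in> {p..<c + 1}. P c'} = (if P c then insert c {c' \<in> {p..<c}. P c'} else {c' \<in> {p..<c::int}. P c'})"
  by (auto, metis order_le_imp_less_or_eq)

lemma card_atLeastLessThan_plus1:
  assumes "p \<le> (c::int)"
  shows "card {c' \<in> {p..<c + 1}. P c'} = card {c' \<in> {p..<c}. P c'} + (if P c then 1 else 0)"
proof -
  have "finite {c' \<in> {p..<c}. P c'}" by (rule finite_subset[of _ "{p..<c}"]) auto
  then show ?thesis
    using card_insert_disjoint[of "{c' \<in> {p..<c}. P c'}" c]
    unfolding atLeastLessThan_plus1[OF assms] by auto
qed

lemma nup_plus1: "p \<le> c \<Longrightarrow> nup up p (c + 1) = nup up p c + (if up c then 1 else 0)"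
  and nrt_plus1: "p \<le> c \<Longrightarrow> nrt up p (c + 1) = nrt up p c + (if up c then 0 else 1)"
  unfolding nup_def nrt_def using card_atLeastLessThan_plus1[of p c] by auto

lemma nup_mono: "c \<le> d \<Longrightarrow> nup up p c \<le> nup up p d"
  and nrt_mono: "c \<le> d \<Longrightarrow> nrt up p c \<le> nrt up p d"
  unfolding nup_def nrt_def by (auto intro!: card_mono finite_subset[of _ "{p..<d}"])

lemma nup_nrt: "p \<le> c \<Longrightarrow> int (nup up p c) + int (nrt up p c) = c - p"
  by (induction c rule: int_ge_induct) (simp_all add: nup_plus1 nrt_plus1)

lemma nup_surj: "p \<le> q \<Longrightarrow> k \<le> nup up p q \<Longrightarrow> \<exists>c\<in>{p..q}. nup up p c = k"
proof (induction q rule: int_ge_induct)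
  case (step q)
  show ?case
  proof (cases "k \<le> nup up p q")
    case True
    from step.IH[OF True] obtain c where "c \<in> {p..q}" "nup up p c = k" by blast
    then show ?thesis by (intro bexI[of _ c]) auto
  next
    case False
    with step show ?thesis by (intro bexI[of _ "q + 1"]) (auto simp: nup_plus1 split: if_splits)
  qed
qed simp

text \<open>The witness is the first content with \<open>k\<close> right steps behind it, that is,
  the bottom cell of column \<open>k + 1\<close>.\<close>

lemma nrt_surj_bottom:
  "p \<le> q \<Longrightarrow> k \<le> nrt up p q \<Longrightarrow> \<exists>c\<in>{p..q}. nrt up p c = k \<and> (c = p \<or> \<not> up (c - 1))"
proof (induction q rule: int_ge_induct)
  case (step q)
  show ?case
  proof (cases "k \<le> nrt up p q")
    case True
    from step.IH[OF True] obtain c where "c \<in> {p..q}" "nrt up p c = k" "c = p \<or> \<not> up (c - 1)" by blast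
    then show ?thesis by (intro bexI[of _ c]) auto
  next
    case False
    with step show ?thesis by (intro bexI[of _ "q + 1"]) (auto simp: nrt_plus1 split: if_splits)
  qed
qed simp

text \<open>The top cell of a column comes just before the bottom cell of the next one, hence the
  detour through \<open>Suc k\<close>; the last column has its top at \<open>q\<close>.\<close>

lemma nrt_surj_top:
  assumes "p \<le> q" "k \<le> nrt up p q"
  shows "\<exists>c\<in>{p..q}. nrt up p c = k \<and> (c = q \<or> \<not> up c)"
proof (cases "k = nrt up p q")
  case False
  with assms have "Suc k \<le> nrt up p q" by simp
  from nrt_surj_bottom[OF assms(1) this] obtain c where c: "c \<in> {p..q}" "nrt up p c = Suc k"
    "c = p \<or> \<not> up (c - 1)" by auto
  then have "p < c" "\<not> up (c - 1)" by (cases "c = p"; auto)+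
  then show ?thesis using c nrt_plus1[of p "c - 1" up] by (intro bexI[of _ "c - 1"]) auto
qed (use assms in auto)

lemma strip_row_cols:
  "{snd g | g. g \<in> strip_cells up p q \<and> fst g = i}
    = (\<lambda>c. 1 + nrt up p c) ` {c \<in> {p..q}. 1 + nup up p q - nup up p c = i}"
  by (auto simp: strip_cells_def strip_cell_def image_iff)

lemma strip_row_nonempty:
  assumes "p \<le> q" "1 \<le> i" "i \<le> 1 + nup up p q"
  shows "{c \<in> {p..q}. 1 + nup up p q - nup up p c = i} \<noteq> {}"
  using nup_surj[OF assms(1), of "1 + nup up p q - i" up] assms by force

lemma finite_strip_row: "finite {c \<in> {p..q::int}. P c}"
  by (rule finite_subset[of _ "{p..q}"]) auto

lemma nth_upt_1: "1 \<le> i \<Longrightarrow> i \<le> 1 + n \<Longrightarrow> [1..<2 + n] ! (i - 1) = i"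
  by (simp add: nth_upt del: upt_Suc)

lemma prow_strip_outer:
  assumes "p \<le> q" "1 \<le> i" "i \<le> 1 + nup up p q"
  shows "s \<le> prow (strip_outer up p q) i \<longleftrightarrow>
    (\<exists>c\<in>{p..q}. 1 + nup up p q - nup up p c = i \<and> s \<le> 1 + nrt up p c)"
proof -
  let ?M = "(\<lambda>c. 1 + nrt up p c) ` {c \<in> {p..q}. 1 + nup up p q - nup up p c = i}"
  have "i - 1 < length [1..<2 + nup up p q]" using assms by (simp only: length_upt)
  then have "prow (strip_outer up p q) i = Max ?M"
    unfolding prow_def strip_outer_def nth_map[OF \<open>i - 1 < _\<close>] nth_upt_1[OF assms(2,3)] strip_row_cols
    using assms by simp
  moreover have "s \<le> Max ?M \<longleftrightarrow> (\<exists>x\<in>?M. s \<le> x)"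
    using strip_row_nonempty[OF assms] by (intro Max_ge_iff finite_imageI finite_strip_row) simp
  ultimately show ?thesis by auto
qed

lemma prow_strip_inner:
  assumes "p \<le> q" "1 \<le> i" "i \<le> 1 + nup up p q" "1 \<le> s"
  shows "s \<le> prow (strip_inner up p q) i \<longleftrightarrow>
    (\<forall>c\<in>{p..q}. 1 + nup up p q - nup up p c = i \<longrightarrow> s < 1 + nrt up p c)"
proof -
  let ?M = "(\<lambda>c. 1 + nrt up p c) ` {c \<in> {p..q}. 1 + nup up p q - nup up p c = i}"
  have "i - 1 < length [1..<2 + nup up p q]" using assms by (simp only: length_upt)
  then have "prow (strip_inner up p q) i = Min ?M - 1"
    unfolding prow_def strip_inner_def nth_map[OF \<open>i - 1 < _\<close>] nth_upt_1[OF assms(2,3)] strip_row_cols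
    using assms by simp
  moreover have "s \<le> Min ?M - 1 \<longleftrightarrow> s < Min ?M" using assms(4) by auto
  moreover have "s < Min ?M \<longleftrightarrow> (\<forall>x\<in>?M. s < x)"
    using strip_row_nonempty[OF assms(1-3)] by (intro Min_gr_iff finite_imageI finite_strip_row) simp
  ultimately show ?thesis by auto
qed

lemma length_strip [simp]:
  "length (strip_outer up p q) = 1 + nup up p q" "length (strip_inner up p q) = 1 + nup up p q"
  by (simp_all add: strip_outer_def strip_inner_def)

text \<open>Cells before \<open>c\<close> lie further left, because the step into \<open>c\<close>
  goes right; so exactly the rows from the top down to that of \<open>c\<close> extend to its
  column.\<close>

lemma pconj_strip_outer:
  assumes pq: "p \<le> q" and c: "c \<in> {p..q}" "c = p \<or> \<not> up (c - 1)"
  shows "pconj (strip_outer up p q) (1 + nrt up p c) = 1 + nup up p q - nup up p c"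
proof -
  have "{i \<in> {1..length (strip_outer up p q)}. 1 + nrt up p c \<le> prow (strip_outer up p q) i}
    = {1..1 + nup up p q - nup up p c}"
  proof (intro equalityI subsetI)
    fix i assume "i \<in> {i \<in> {1..length (strip_outer up p q)}. 1 + nrt up p c \<le> prow (strip_outer up p q) i}"
    then have i: "1 \<le> i" "i \<le> 1 + nup up p q" and "1 + nrt up p c \<le> prow (strip_outer up p q) i" by auto
    then obtain d where d: "d \<in> {p..q}" "1 + nup up p q - nup up p d = i" "nrt up p c \<le> nrt up p d"
      by (auto simp: prow_strip_outer[OF pq i])
    have "c \<le> d"
    proof (rule ccontr)
      assume "\<not> c \<le> d"
      then have "d \<le> c - 1" "\<not> up (c - 1)" "p \<le> c - 1" using c d(1) by auto
      then show False using nrt_mono[of d "c - 1" up p] d(3) nrt_plus1[of p "c - 1" up] by simp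
    qed
    then show "i \<in> {1..1 + nup up p q - nup up p c}" using nup_mono[of c d up p] d(2) i by auto
  next
    fix i assume "i \<in> {1..1 + nup up p q - nup up p c}"
    then have i: "1 \<le> i" "i \<le> 1 + nup up p q" "i \<le> 1 + nup up p q - nup up p c" by auto
    obtain d where d: "d \<in> {p..q}" "nup up p d = 1 + nup up p q - i"
      using nup_surj[OF pq, of "1 + nup up p q - i" up] i by (force simp del: atLeastAtMost_iff)
    have "nup up p c \<le> nup up p q" using nup_mono[of c q] c by auto
    have "\<exists>d\<in>{p..q}. 1 + nup up p q - nup up p d = i \<and> nrt up p c \<le> nrt up p d"
    proof (cases "c \<le> d")
      case True
      then show ?thesis using d i nrt_mono[of c d up p] by (intro bexI[of _ d]) auto
    next
      \<comment> \<open>The cell found comes before \<open>c\<close>, so its row \<open>i\<close> is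
        not above that of \<open>c\<close>; by assumption it is not below it either. Hence
        \<open>c\<close> itself lies in row \<open>i\<close>.\<close>
      case False
      then have "nup up p d \<le> nup up p c" using nup_mono[of d c] by simp
      then have "nup up p c = 1 + nup up p q - i" using d(2) i \<open>nup up p c \<le> nup up p q\<close> by linarith
      then show ?thesis using i c by (intro bexI[of _ c]) auto
    qed
    then show "i \<in> {i \<in> {1..length (strip_outer up p q)}. 1 + nrt up p c \<le> prow (strip_outer up p q) i}"
      using i prow_strip_outer[OF pq i(1,2), of "1 + nrt up p c"] by auto
  qed
  then show ?thesis by (simp add: pconj_def)
qed

text \<open>Exactly the rows above that of the top cell \<open>c\<close> start right of its column.
  They are counted from the definition of \<open>pconj\<close>, since \<open>strip_inner\<close> has
  the entry 0 in the row of the head and so is no partition in the sense of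
  \<open>is_partition\<close>.\<close>

lemma pconj_strip_inner:
  assumes pq: "p \<le> q" and c: "c \<in> {p..q}" "c = q \<or> \<not> up c"
  shows "pconj (strip_inner up p q) (1 + nrt up p c) = nup up p q - nup up p c"
proof -
  have cq: "nup up p c \<le> nup up p q" using nup_mono[of c q] c by auto
  have "{i \<in> {1..length (strip_inner up p q)}. 1 + nrt up p c \<le> prow (strip_inner up p q) i}
    = {1..nup up p q - nup up p c}"
  proof (intro equalityI subsetI)
    fix i assume "i \<in> {i \<in> {1..length (strip_inner up p q)}. 1 + nrt up p c \<le> prow (strip_inner up p q) i}"
    then have i: "1 \<le> i" "i \<le> 1 + nup up p q" and "1 + nrt up p c \<le> prow (strip_inner up p q) i" by auto
    then have all: "\<And>d. d \<in> {p..q} \<Longrightarrow> 1 + nup up p q - nup up p d = i \<Longrightarrow> nrt up p c < nrt up p d"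
      by (auto simp: prow_strip_inner[OF pq i])
    show "i \<in> {1..nup up p q - nup up p c}"
    proof (rule ccontr)
      assume "i \<notin> {1..nup up p q - nup up p c}"
      then have ic: "1 + nup up p q - i \<le> nup up p c" using i by auto
      obtain d where d: "d \<in> {p..q}" "nup up p d = 1 + nup up p q - i"
        using nup_surj[OF pq, of "1 + nup up p q - i" up] i by (force simp del: atLeastAtMost_iff)
      then have "nrt up p c < nrt up p d" using i by (intro all) auto
      then have "c \<le> d" using nrt_mono[of d c up p] by linarith
      then have "nup up p c = nup up p d" using nup_mono[of c d up p] ic d by simp
      then have "nrt up p c < nrt up p c" using d i by (intro all c) auto
      then show False by simp
    qed
  next
    fix i assume "i \<in> {1..nup up p q - nup up p c}"
    then have i: "1 \<le> i" "i \<le> 1 + nup up p q" "i \<le> nup up p q - nup up p c" by auto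
    have "nrt up p c < nrt up p d" if d: "d \<in> {p..q}" "1 + nup up p q - nup up p d = i" for d
    proof -
      have "nup up p c < nup up p d" using d i cq by linarith
      then have "c < d" using nup_mono[of d c up p] by linarith
      then have "\<not> up c" "c + 1 \<le> d" using c d by auto
      then show ?thesis using nrt_mono[of "c + 1" d up p] nrt_plus1[of p c up] c by simp
    qed
    then show "i \<in> {i \<in> {1..length (strip_inner up p q)}. 1 + nrt up p c \<le> prow (strip_inner up p q) i}"
      using i prow_strip_inner[OF pq i(1,2), of "1 + nrt up p c"] by auto
  qed
  then show ?thesis by (simp add: pconj_def)
qed

lemma prow_strip_outer_1:
  assumes "p \<le> q"
  shows "prow (strip_outer up p q) 1 = 1 + nrt up p q"
proof -
  have iff: "s \<le> prow (strip_outer up p q) 1 \<longleftrightarrow> s \<le> 1 + nrt up p q" for s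
  proof -
    have "(\<exists>c\<in>{p..q}. 1 + nup up p q - nup up p c = 1 \<and> s \<le> 1 + nrt up p c) \<longleftrightarrow> s \<le> 1 + nrt up p q"
      using nrt_mono[of _ q up p] assms by (force intro: order.trans)
    then show ?thesis by (subst prow_strip_outer[OF assms]) auto
  qed
  show ?thesis using iff[of "prow (strip_outer up p q) 1"] iff[of "1 + nrt up p q"] by simp
qed

section \<open>Contents of the column ends of a sub-ribbon\<close>

abbreviation bottom_content :: "nat list \<Rightarrow> int \<Rightarrow> nat \<Rightarrow> int" where
  "bottom_content kap r i \<equiv> rcontent kap r (pconj kap i, i)"

abbreviation top_content :: "nat list \<Rightarrow> nat list \<Rightarrow> int \<Rightarrow> nat \<Rightarrow> int" where
  "top_content kap nu r j \<equiv> rcontent kap r (pconj nu j + 1, j)"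

lemma pconj_strip_outer_1:
  assumes "p \<le> q"
  shows "pconj (strip_outer up p q) 1 = 1 + nup up p q"
  using pconj_strip_outer[of p q p up] assms by simp

text \<open>The normalised head lies in row \<open>1 + nup up p q\<close> and column 1, so root
  content \<open>p\<close> gives it content \<open>p\<close>. Contents in the ribbon are therefore
  those of the cutting strip, and flags can be looked up by content.\<close>

lemma bottom_content_strip:
  assumes "p \<le> q" "c \<in> {p..q}" "c = p \<or> \<not> up (c - 1)"
  shows "bottom_content (strip_outer up p q) p (1 + nrt up p c) = c"
  using pconj_strip_outer[of p q c up] pconj_strip_outer_1[of p q up] nup_nrt[of p c up] assms
    nup_mono[of c q up p]
  by (simp add: rcontent_def of_nat_diff)

lemma top_content_strip:
  assumes "p \<le> q" "c \<in> {p..q}" "c = q \<or> \<not> up c"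
  shows "top_content (strip_outer up p q) (strip_inner up p q) p (1 + nrt up p c) = c"
  using pconj_strip_inner[of p q c up] pconj_strip_outer_1[of p q up] nup_nrt[of p c up] assms
    nup_mono[of c q up p]
  by (simp add: rcontent_def of_nat_diff)

lemma sorted_list_of_strict_mono_image:
  fixes f :: "nat \<Rightarrow> 'b::linorder"
  assumes "\<And>s s'. s \<in> {m..<n} \<Longrightarrow> s' \<in> {m..<n} \<Longrightarrow> s < s' \<Longrightarrow> f s < f s'"
  shows "map f [m..<n] = sorted_list_of_set (f ` {m..<n})"
proof -
  have "sorted_wrt (<) (map f [m..<n])"
    unfolding sorted_wrt_map using assms
    by (intro sorted_wrt_mono_rel[OF _ sorted_wrt_upt]) auto
  then have "sorted_list_of_set (set (map f [m..<n])) = map f [m..<n]"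
    by (intro sorted_list_of_set.idem_if_sorted_distinct) (auto simp: strict_sorted_iff)
  then show ?thesis by simp
qed

lemma strip_bottom_list:
  assumes "p \<le> q"
  shows "map (bottom_content (strip_outer up p q) p) [1..<2 + nrt up p q]
    = sorted_list_of_set (insert p {c + 1 | c. p \<le> c \<and> c < q \<and> \<not> up c})"
proof -
  let ?d = "bottom_content (strip_outer up p q) p"
  let ?I = "insert p {c + 1 | c. p \<le> c \<and> c < q \<and> \<not> up c}"
  have I: "c \<in> ?I \<longleftrightarrow> c \<in> {p..q} \<and> (c = p \<or> \<not> up (c - 1))" for c
    using assms by (auto intro!: exI[of _ "c - 1"])
  have ex: "\<exists>c\<in>?I. nrt up p c = s - 1 \<and> ?d s = c" if "s \<in> {1..<2 + nrt up p q}" for s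
  proof -
    have s: "s - 1 \<le> nrt up p q" using that by auto
    obtain c where "c \<in> {p..q}" "nrt up p c = s - 1" "c = p \<or> \<not> up (c - 1)"
      using nrt_surj_bottom[OF assms s] by blast
    then show ?thesis using bottom_content_strip[OF assms, of c up] that I by (intro bexI[of _ c]) auto
  qed
  have "?d s < ?d s'" if ss: "s \<in> {1..<2 + nrt up p q}" "s' \<in> {1..<2 + nrt up p q}" "s < s'" for s s'
  proof -
    obtain c where c: "nrt up p c = s - 1" "?d s = c" using ex[OF ss(1)] by auto
    obtain c' where c': "nrt up p c' = s' - 1" "?d s' = c'" using ex[OF ss(2)] by auto
    show ?thesis using c c' ss nrt_mono[of c' c up p] by (cases "c < c'") auto
  qed
  then have "map ?d [1..<2 + nrt up p q] = sorted_list_of_set (?d ` {1..<2 + nrt up p q})"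
    by (rule sorted_list_of_strict_mono_image)
  also have "?d ` {1..<2 + nrt up p q} = ?I"
  proof (intro equalityI subsetI)
    fix c assume "c \<in> ?I"
    then have c: "c \<in> {p..q}" "c = p \<or> \<not> up (c - 1)" by (simp_all only: I)
    then have "1 + nrt up p c \<in> {1..<2 + nrt up p q}" using nrt_mono[of c q up p] by auto
    then show "c \<in> ?d ` {1..<2 + nrt up p q}" by (intro image_eqI[where x = "1 + nrt up p c"]) (use bottom_content_strip[OF assms c(1), of up] c(2) in auto)
  qed (use ex in blast)
  finally show ?thesis .
qed

text \<open>The shift by one gives the top of a column the label of the bottom of the next column.
  So this list of labels differs from that of the bottoms only in having \<open>q + 1\<close> in
  place of \<open>p\<close>.\<close>

lemma strip_top_list:
  assumes "p \<le> q"
  shows "map (\<lambda>s. top_content (strip_outer up p q) (strip_inner up p q) p s + 1) [1..<2 + nrt up p q]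
    = sorted_list_of_set (insert (q + 1) {c + 1 | c. p \<le> c \<and> c < q \<and> \<not> up c})"
proof -
  let ?g = "\<lambda>s. top_content (strip_outer up p q) (strip_inner up p q) p s + 1"
  let ?J = "insert (q + 1) {c + 1 | c. p \<le> c \<and> c < q \<and> \<not> up c}"
  have J: "c + 1 \<in> ?J \<longleftrightarrow> c \<in> {p..q} \<and> (c = q \<or> \<not> up c)" for c
    using assms by auto
  have ex: "\<exists>c. c + 1 \<in> ?J \<and> nrt up p c = s - 1 \<and> ?g s = c + 1" if "s \<in> {1..<2 + nrt up p q}" for s
  proof -
    have s: "s - 1 \<le> nrt up p q" using that by auto
    obtain c where "c \<in> {p..q}" "nrt up p c = s - 1" "c = q \<or> \<not> up c"
      using nrt_surj_top[OF assms s] by blast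
    then show ?thesis using top_content_strip[OF assms, of c up] that J by (intro exI[of _ c]) auto
  qed
  have "?g s < ?g s'" if ss: "s \<in> {1..<2 + nrt up p q}" "s' \<in> {1..<2 + nrt up p q}" "s < s'" for s s'
  proof -
    obtain c where c: "nrt up p c = s - 1" "?g s = c + 1" using ex[OF ss(1)] by auto
    obtain c' where c': "nrt up p c' = s' - 1" "?g s' = c' + 1" using ex[OF ss(2)] by auto
    show ?thesis using c c' ss nrt_mono[of c' c up p] by (cases "c < c'") auto
  qed
  then have "map ?g [1..<2 + nrt up p q] = sorted_list_of_set (?g ` {1..<2 + nrt up p q})"
    by (rule sorted_list_of_strict_mono_image)
  also have "?g ` {1..<2 + nrt up p q} = ?J"
  proof (intro equalityI subsetI)
    fix c assume "c \<in> ?J"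
    then have "c - 1 + 1 \<in> ?J" by simp
    then have c: "c - 1 \<in> {p..q}" "c - 1 = q \<or> \<not> up (c - 1)" by (simp_all only: J)
    then have "1 + nrt up p (c - 1) \<in> {1..<2 + nrt up p q}" using nrt_mono[of "c - 1" q up p] by auto
    then show "c \<in> ?g ` {1..<2 + nrt up p q}" by (intro image_eqI[where x = "1 + nrt up p (c - 1)"]) (use top_content_strip[OF assms c(1), of up] c(2) in auto)
  qed (use ex in fastforce)
  finally show ?thesis .
qed

text \<open>The rows and columns of a ribbon with turns \<open>T\<close> share the labels \<open>T\<close>, and flipping at all of them
  leaves a single entry.\<close>

lemma ribbon_minor:
  fixes U :: "'i::linorder \<Rightarrow> 'i \<Rightarrow> 'a::comm_ring_1"
  assumes U: "unitri U" and "p < l" and "distinct ts"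
    and T: "T = {t \<in> set ts. p < t \<and> t < l}"
  shows "minor U (insert p T) (insert l T) = foldr flip ts U p l"
proof -
  define us where "us = filter (\<lambda>t. p < t \<and> t < l) ts"
  have us: "set us = T" "distinct us" "p \<notin> T" "l \<notin> T" "finite T" using assms by (auto simp: us_def)
  have "minor U (insert p T) (insert l T) =
    (- 1) ^ (\<Sum>t | t \<in> set us \<and> (t \<in> insert p T) \<noteq> (t \<in> insert l T).
        card {i \<in> insert p T. i < t} + card {j \<in> insert l T. j \<le> t})
    * minor (foldr flip us U) ((insert p T - set us) \<union> (set us - insert l T))
        ((insert l T - set us) \<union> (set us - insert p T))"
    by (rule minor_flips) (use us U in auto)
  \<comment> \<open>Every flipped label is in both index sets, so no sign arises.\<close>
  also have "{t. t \<in> set us \<and> (t \<in> insert p T) \<noteq> (t \<in> insert l T)} = {}" using us by auto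
  also have "(insert p T - set us) \<union> (set us - insert l T) = {p}" using us by auto
  also have "(insert l T - set us) \<union> (set us - insert p T) = {l}" using us by auto
  also have "minor (foldr flip us U) {p} {l} = foldr flip us U p l"
    unfolding minor_def mdet_def by (simp add: det_single)
  also have "\<dots> = foldr flip ts U p l" unfolding us_def by (rule foldr_flip_filter) simp
  finally show ?thesis by simp
qed

section \<open>Flagged determinants as minors\<close>

definition content_entry :: "(int \<Rightarrow> 'a::comm_ring_1) \<Rightarrow> (int \<Rightarrow> 'a) \<Rightarrow> (int \<Rightarrow> int) \<Rightarrow> (int \<Rightarrow> int) \<Rightarrow> int \<Rightarrow> int \<Rightarrow> 'a" where
  "content_entry y z al be p l =
    esuper (l - p) (vseg y (al (l - 1)) (be p)) (vseg z (al (l - 1) + (l - 1)) (be p + p))"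

lemma Sflag_eq_mdet_entry:
  "Sflag kap nu r N a b y z = mdet (\<lambda>i j.
     esuper (int (pconj kap i) - int i - int (pconj nu j) + int j) (vseg y (a j) (b i))
       (vseg z (a j + top_content kap nu r j) (b i + bottom_content kap r i))) [1..<N + 1] [1..<N + 1]"
  unfolding Sflag_def mdet_def Let_def by (intro arg_cong[of _ _ det] eq_matI) (auto simp del: upt_Suc)

text \<open>The index of \<open>esuper\<close> is a column label minus a row label: the root content
  and the length of the first column cancel, and the shift of the column label absorbs the 1 in the
  row of the top cell.\<close>

lemma mdet_content_entry:
  assumes "\<And>i. i \<in> set xs \<Longrightarrow> b i = be (bottom_content kap r i)"
    and "\<And>j. j \<in> set xs \<Longrightarrow> a j = al (top_content kap nu r j)"
  shows "mdet (\<lambda>i j.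
     esuper (int (pconj kap i) - int i - int (pconj nu j) + int j) (vseg y (a j) (b i))
       (vseg z (a j + top_content kap nu r j) (b i + bottom_content kap r i))) xs xs
    = mdet (content_entry y z al be) (map (bottom_content kap r) xs) (map (\<lambda>j. top_content kap nu r j + 1) xs)"
  unfolding mdet_map content_entry_def
proof (rule mdet_cong)
  fix i j assume "i \<in> set xs" "j \<in> set xs"
  moreover have "top_content kap nu r j + 1 - bottom_content kap r i
    = int (pconj kap i) - int i - int (pconj nu j) + int j"
    by (simp add: rcontent_def)
  ultimately show "esuper (int (pconj kap i) - int i - int (pconj nu j) + int j) (vseg y (a j) (b i))
       (vseg z (a j + top_content kap nu r j) (b i + bottom_content kap r i)) =
    esuper (top_content kap nu r j + 1 - bottom_content kap r i)
      (vseg y (al (top_content kap nu r j + 1 - 1)) (be (bottom_content kap r i)))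
      (vseg z (al (top_content kap nu r j + 1 - 1) + (top_content kap nu r j + 1 - 1))
         (be (bottom_content kap r i) + bottom_content kap r i))"
    using assms by simp
qed

lemma esym_0 [simp]: "esym 0 xs = 1"
proof -
  have "{S. S \<subseteq> {..<length xs} \<and> card S = 0} = {{}}"
    by (auto dest: finite_subset[OF _ finite_lessThan])
  then show ?thesis by (simp add: esym_def)
qed

lemma hsym_0 [simp]: "hsym 0 xs = 1"
proof -
  have "{al. (\<forall>i. length xs \<le> i \<longrightarrow> al i = 0) \<and> (\<Sum>i<length xs. al i) = 0} = {\<lambda>_. 0 :: nat}"
    by (auto simp: fun_eq_iff) (metis lessThan_iff not_le)
  then show ?thesis by (simp add: hsym_def)
qed

lemma esuper_0 [simp]: "esuper 0 xs ws = 1"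
  by (simp add: esuper_def)

lemma esuper_neg: "n < 0 \<Longrightarrow> esuper n xs ws = 0"
  by (simp add: esuper_def)

lemma unitri_content_entry: "unitri (content_entry y z al be)"
  by (simp add: unitri_def content_entry_def esuper_neg)

lemma Sflag_strip:
  assumes pq: "p \<le> q" and "distinct ts"
    and T: "{c + 1 | c. p \<le> c \<and> c < q \<and> \<not> up c} = {t \<in> set ts. p < t \<and> t < q + 1}"
  shows "Sflag (strip_outer up p q) (strip_inner up p q) p (prow (strip_outer up p q) 1)
      (\<lambda>s. al (top_content (strip_outer up p q) (strip_inner up p q) p s))
      (\<lambda>s. be (bottom_content (strip_outer up p q) p s)) y z
    = foldr flip ts (content_entry y z al be) p (q + 1)"
proof -
  let ?kap = "strip_outer up p q" and ?nu = "strip_inner up p q" and ?U = "content_entry y z al be"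
  let ?T = "{c + 1 | c. p \<le> c \<and> c < q \<and> \<not> up c}"
  have N: "prow ?kap 1 + 1 = 2 + nrt up p q" using prow_strip_outer_1[OF pq] by simp
  have "Sflag ?kap ?nu p (prow ?kap 1) (\<lambda>s. al (top_content ?kap ?nu p s)) (\<lambda>s. be (bottom_content ?kap p s)) y z
    = mdet ?U (map (bottom_content ?kap p) [1..<2 + nrt up p q])
        (map (\<lambda>s. top_content ?kap ?nu p s + 1) [1..<2 + nrt up p q])"
    unfolding Sflag_eq_mdet_entry N by (rule mdet_content_entry) auto
  also have "\<dots> = minor ?U (insert p ?T) (insert (q + 1) ?T)"
    unfolding strip_bottom_list[OF pq] strip_top_list[OF pq] minor_def ..
  also have "\<dots> = foldr flip ts ?U p (q + 1)"
    by (rule ribbon_minor) (use assms unitri_content_entry in auto)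
  finally show ?thesis .
qed

section \<open>Skew shapes and ribbons\<close>

lemma prow_antimono:
  assumes "is_partition lam" "1 \<le> i" "i \<le> i'"
  shows "prow lam i' \<le> prow lam i"
proof (cases "i = i' \<or> length lam < i'")
  case False
  have "sorted_wrt (\<lambda>x y. y \<le> x) lam" using assms by (simp add: is_partition_def)
  from sorted_wrt_nth_less[OF this, of "i - 1" "i' - 1"] False assms show ?thesis
    by (auto simp: prow_def)
qed (auto simp: prow_def)

text \<open>Row lengths weakly decrease, so the rows reaching column \<open>j\<close> form an
  initial segment, and its size decides membership.\<close>

lemma le_prow_iff:
  assumes "is_partition lam" "1 \<le> i" "1 \<le> j"
  shows "j \<le> prow lam i \<longleftrightarrow> i \<le> pconj lam j"
proof -
  let ?S = "{i \<in> {1..length lam}. j \<le> prow lam i}"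
  have "finite ?S" by simp
  have down: "i' \<in> ?S" if "i \<in> ?S" "1 \<le> i'" "i' \<le> i" for i i'
    using that prow_antimono[OF assms(1), of i' i] by auto
  have "j \<le> prow lam i \<longleftrightarrow> i \<in> ?S" using assms(2,3) by (auto simp: prow_def split: if_splits)
  also have "\<dots> \<longleftrightarrow> i \<le> card ?S"
  proof
    assume "i \<in> ?S"
    then have "{1..i} \<subseteq> ?S" using down by fastforce
    from card_mono[OF \<open>finite ?S\<close> this] show "i \<le> card ?S" by simp
  next
    assume le: "i \<le> card ?S"
    show "i \<in> ?S"
    proof (rule ccontr)
      assume i: "i \<notin> ?S"
      have "x < i" if "x \<in> ?S" for x using i down[OF that, of i] assms(2) by (meson not_le)
      then have "?S \<subseteq> {1..<i}" by auto
      from card_mono[OF _ this] le assms(2) show False by simp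
    qed
  qed
  finally show ?thesis by (simp add: pconj_def)
qed

lemma pconj_antimono:
  assumes "j \<le> j'"
  shows "pconj lam j' \<le> pconj lam j"
  unfolding pconj_def by (rule card_mono) (use assms in auto)

lemma mem_skew_iff:
  assumes "is_partition lam" "is_partition mu"
  shows "(i, j) \<in> skew lam mu \<longleftrightarrow> 1 \<le> j \<and> pconj mu j < i \<and> i \<le> pconj lam j"
  using le_prow_iff[OF assms(1), of i j] le_prow_iff[OF assms(2), of i j]
  by (cases "1 \<le> i \<and> 1 \<le> j") (auto simp: skew_def)

lemma pconj_le_if_subpart:
  assumes "is_partition lam" "is_partition mu" "subpart mu lam" "1 \<le> j"
  shows "pconj mu j \<le> pconj lam j"
proof (cases "pconj mu j = 0")
  case False
  then have "j \<le> prow mu (pconj mu j)" using assms by (subst le_prow_iff) auto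
  also have "\<dots> \<le> prow lam (pconj mu j)" using assms by (simp add: subpart_def)
  finally show ?thesis using assms False by (subst (asm) le_prow_iff) auto
qed simp

text \<open>A discrete intermediate value theorem along a path in \<open>S\<close>, used with the
  content as \<open>f\<close> and also with the column number.\<close>

lemma edge_connected_crossing:
  fixes f :: "cell \<Rightarrow> int"
  assumes "edge_connected S" "x \<in> S" "y \<in> S" "f x \<le> c" "c < f y"
    and step: "\<And>u v. edge_adj u v \<Longrightarrow> f v \<le> f u + 1"
  shows "\<exists>u\<in>S. \<exists>v\<in>S. edge_adj u v \<and> f u = c \<and> f v = c + 1"
proof -
  have "(x, y) \<in> {(u, v). u \<in> S \<and> v \<in> S \<and> edge_adj u v}\<^sup>*"
    using assms by (auto simp: edge_connected_def)
  then have "f y \<le> c \<or> ?thesis"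
  proof (induction rule: rtrancl_induct)
    case (step u v)
    then have "u \<in> S" "v \<in> S" "edge_adj u v" by auto
    show ?case
    proof (cases "f u \<le> c \<and> c < f v")
      case True
      then have "f u = c" "f v = c + 1" using assms(6)[OF \<open>edge_adj u v\<close>] by auto
      then show ?thesis using \<open>u \<in> S\<close> \<open>v \<in> S\<close> \<open>edge_adj u v\<close> by blast
    qed (use step in auto)
  qed (use assms in auto)
  then show ?thesis using assms by auto
qed

text \<open>Order convexity is the property kept of a skew diagram, so that the shape and the
  ribbons in it share one theory. Using the same shift \<open>k\<close> for both makes their
  contents comparable.\<close>

locale skew_shape =
  fixes D :: "cell set" and k :: int
  assumes convex: "\<And>i j i' j' a b. (i, j) \<in> D \<Longrightarrow> (i', j') \<in> D \<Longrightarrow>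
      i \<le> a \<Longrightarrow> a \<le> i' \<Longrightarrow> j \<le> b \<Longrightarrow> b \<le> j' \<Longrightarrow> (a, b) \<in> D"
    and pos: "\<And>i j. (i, j) \<in> D \<Longrightarrow> 1 \<le> i \<and> 1 \<le> j"
    and fin: "finite D" and ne: "D \<noteq> {}"
begin

definition ct :: "cell \<Rightarrow> int" where
  "ct g = int (snd g) - int (fst g) + k"

lemma ct_pair [simp]: "ct (i, j) = int j - int i + k"
  by (simp add: ct_def)

lemma rtail_props:
  "rtail D \<in> D \<and> (\<forall>d\<in>D. fst (rtail D) \<le> fst d \<and> (fst d = fst (rtail D) \<longrightarrow> snd d \<le> snd (rtail D)))"
proof -
  define i where "i = Min (fst ` D)"
  define j where "j = Max (snd ` {d \<in> D. fst d = i})"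
  have i: "i \<in> fst ` D" "\<And>d. d \<in> D \<Longrightarrow> i \<le> fst d"
    unfolding i_def using fin ne by (auto intro: Min_in)
  have "finite {d \<in> D. fst d = i}" "{d \<in> D. fst d = i} \<noteq> {}" using fin i(1) by auto
  then have "j \<in> snd ` {d \<in> D. fst d = i}" and j: "\<And>d. d \<in> D \<Longrightarrow> fst d = i \<Longrightarrow> snd d \<le> j"
    unfolding j_def by (auto intro: Max_in)
  then have "(i, j) \<in> D" by auto
  have "\<exists>!g. g \<in> D \<and> (\<forall>d\<in>D. fst g \<le> fst d \<and> (fst d = fst g \<longrightarrow> snd d \<le> snd g))"
  proof (rule ex1I[of _ "(i, j)"])
    show "(i, j) \<in> D \<and> (\<forall>d\<in>D. fst (i, j) \<le> fst d \<and> (fst d = fst (i, j) \<longrightarrow> snd d \<le> snd (i, j)))"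
      using \<open>(i, j) \<in> D\<close> i j by auto
    fix g assume "g \<in> D \<and> (\<forall>d\<in>D. fst g \<le> fst d \<and> (fst d = fst g \<longrightarrow> snd d \<le> snd g))"
    then show "g = (i, j)" using \<open>(i, j) \<in> D\<close> i(2)[of g] j[of g] by (force simp: prod_eq_iff)
  qed
  from theI'[OF this] show ?thesis by (simp add: rtail_def)
qed

lemma rhead_props:
  "rhead D \<in> D \<and> (\<forall>d\<in>D. fst d \<le> fst (rhead D) \<and> (fst d = fst (rhead D) \<longrightarrow> snd (rhead D) \<le> snd d))"
proof -
  define i where "i = Max (fst ` D)"
  define j where "j = Min (snd ` {d \<in> D. fst d = i})"
  have i: "i \<in> fst ` D" "\<And>d. d \<in> D \<Longrightarrow> fst d \<le> i"
    unfolding i_def using fin ne by (auto intro: Max_in)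
  have "finite {d \<in> D. fst d = i}" "{d \<in> D. fst d = i} \<noteq> {}" using fin i(1) by auto
  then have "j \<in> snd ` {d \<in> D. fst d = i}" and j: "\<And>d. d \<in> D \<Longrightarrow> fst d = i \<Longrightarrow> j \<le> snd d"
    unfolding j_def by (auto intro: Min_in)
  then have "(i, j) \<in> D" by auto
  have "\<exists>!g. g \<in> D \<and> (\<forall>d\<in>D. fst d \<le> fst g \<and> (fst d = fst g \<longrightarrow> snd g \<le> snd d))"
  proof (rule ex1I[of _ "(i, j)"])
    show "(i, j) \<in> D \<and> (\<forall>d\<in>D. fst d \<le> fst (i, j) \<and> (fst d = fst (i, j) \<longrightarrow> snd (i, j) \<le> snd d))"
      using \<open>(i, j) \<in> D\<close> i j by auto
    fix g assume "g \<in> D \<and> (\<forall>d\<in>D. fst d \<le> fst g \<and> (fst d = fst g \<longrightarrow> snd g \<le> snd d))"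
    then show "g = (i, j)" using \<open>(i, j) \<in> D\<close> i(2)[of g] j[of g] by (force simp: prod_eq_iff)
  qed
  from theI'[OF this] show ?thesis by (simp add: rhead_def)
qed

lemma rtail_mem: "rtail D \<in> D" and rhead_mem: "rhead D \<in> D"
  using rtail_props rhead_props by auto

text \<open>The tail is the right end of the highest row, but it also lies in the last column: a
  cell further right would by convexity produce a cell right of the tail in its own row.\<close>

lemma ct_rtail_max:
  assumes "d \<in> D"
  shows "ct d \<le> ct (rtail D)" and "ct d = ct (rtail D) \<Longrightarrow> d = rtail D"
proof -
  obtain i j i0 j0 where d: "d = (i, j)" "rtail D = (i0, j0)" by fastforce
  have "i0 \<le> i" using rtail_props assms d by fastforce
  moreover have "j \<le> j0"
  proof (rule ccontr)
    assume "\<not> j \<le> j0"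
    then have "(i0, j) \<in> D" using convex[of i0 j0 i j i0 j] rtail_mem assms d \<open>i0 \<le> i\<close> by auto
    then show False using rtail_props d \<open>\<not> j \<le> j0\<close> by fastforce
  qed
  ultimately show "ct d \<le> ct (rtail D)" "ct d = ct (rtail D) \<Longrightarrow> d = rtail D" unfolding d by auto
qed

lemma ct_rhead_min:
  assumes "d \<in> D"
  shows "ct (rhead D) \<le> ct d" and "ct d = ct (rhead D) \<Longrightarrow> d = rhead D"
proof -
  obtain i j i0 j0 where d: "d = (i, j)" "rhead D = (i0, j0)" by fastforce
  have "i \<le> i0" using rhead_props assms d by fastforce
  moreover have "j0 \<le> j"
  proof (rule ccontr)
    assume "\<not> j0 \<le> j"
    then have "(i0, j) \<in> D" using convex[of i j i0 j0 i0 j] rhead_mem assms d \<open>i \<le> i0\<close> by auto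
    then show False using rhead_props d \<open>\<not> j0 \<le> j\<close> by fastforce
  qed
  ultimately show "ct (rhead D) \<le> ct d" "ct d = ct (rhead D) \<Longrightarrow> d = rhead D" unfolding d by auto
qed

text \<open>A cell of the diagonal strictly northwest of \<open>w\<close> would by convexity bring
  the left neighbour of \<open>w\<close> into \<open>D\<close>. In the same way
  \<open>on_top\<close> singles out the first cell of a diagonal, \<open>on_right\<close> and
  \<open>on_bottom\<close> the last one.\<close>

lemma on_left_min:
  assumes "w \<in> D" "on_left D w" "u \<in> D" "ct u = ct w"
  shows "fst w \<le> fst u"
proof (rule ccontr)
  obtain i j i' j' where w: "w = (i, j)" "u = (i', j')" by fastforce
  assume "\<not> fst w \<le> fst u"
  then have "(i, j - 1) \<in> D" using convex[of i' j' i j i "j - 1"] assms w by auto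
  then show False using assms w by (simp add: on_left_def)
qed

lemma on_top_min:
  assumes "w \<in> D" "on_top D w" "u \<in> D" "ct u = ct w"
  shows "fst w \<le> fst u"
proof (rule ccontr)
  obtain i j i' j' where w: "w = (i, j)" "u = (i', j')" by fastforce
  assume "\<not> fst w \<le> fst u"
  then have "(i - 1, j) \<in> D" using convex[of i' j' i j "i - 1" j] assms w by auto
  then show False using assms w by (simp add: on_top_def)
qed

lemma on_right_max:
  assumes "w \<in> D" "on_right D w" "u \<in> D" "ct u = ct w"
  shows "fst u \<le> fst w"
proof (rule ccontr)
  obtain i j i' j' where w: "w = (i, j)" "u = (i', j')" by fastforce
  assume "\<not> fst u \<le> fst w"
  then have "(i, j + 1) \<in> D" using convex[of i j i' j' i "j + 1"] assms w by auto
  then show False using assms w by (simp add: on_right_def)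
qed

lemma on_bottom_max:
  assumes "w \<in> D" "on_bottom D w" "u \<in> D" "ct u = ct w"
  shows "fst u \<le> fst w"
proof (rule ccontr)
  obtain i j i' j' where w: "w = (i, j)" "u = (i', j')" by fastforce
  assume "\<not> fst u \<le> fst w"
  then have "(i + 1, j) \<in> D" using convex[of i j i' j' "i + 1" j] assms w by auto
  then show False using assms w by (simp add: on_bottom_def)
qed

lemma cell_eqI: "ct u = ct w \<Longrightarrow> fst u = fst w \<Longrightarrow> u = w"
  by (simp add: ct_def prod_eq_iff)

text \<open>Depending on which cell is lower, convexity supplies the left neighbour of
  \<open>w\<close> or the upper neighbour of \<open>x\<close>. This keeps heads at turns apart from
  the labels in \<open>tops\<close>; the next lemma does so for tails and
  \<open>bottoms\<close>.\<close>

lemma not_on_top_on_left: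
  assumes "x \<in> D" "on_top D x" "w \<in> D" "on_left D w" "ct w = ct x + 1"
  shows False
proof -
  obtain i j i' j' where w: "x = (i, j)" "w = (i', j')" by fastforce
  show False
  proof (cases "i \<le> i'")
    case True
    then have "(i', j' - 1) \<in> D" using convex[of i j i' j' i' "j' - 1"] assms w by auto
    then show False using assms w by (simp add: on_left_def)
  next
    case False
    then have "(i - 1, j) \<in> D" using convex[of i' j' i j "i - 1" j] assms w by auto
    then show False using assms w by (simp add: on_top_def)
  qed
qed

lemma not_on_right_on_bottom:
  assumes "x \<in> D" "on_right D x" "w \<in> D" "on_bottom D w" "ct w = ct x + 1"
  shows False
proof -
  obtain i j i' j' where w: "x = (i, j)" "w = (i', j')" by fastforce
  show False
  proof (cases "i' < i")
    case True
    then have "(i' + 1, j') \<in> D" using convex[of i' j' i j "i' + 1" j'] assms w by auto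
    then show False using assms w by (simp add: on_bottom_def)
  next
    case False
    then have "(i, j + 1) \<in> D" using convex[of i j i' j' i "j + 1"] assms w by auto
    then show False using assms w by (simp add: on_right_def)
  qed
qed

definition bottoms :: "int set" where
  "bottoms = ct ` {g \<in> D. on_bottom D g}"

definition tops :: "int set" where
  "tops = (\<lambda>g. ct g + 1) ` {g \<in> D. on_top D g}"

lemma bottomsI: "g \<in> D \<Longrightarrow> on_bottom D g \<Longrightarrow> ct g = p \<Longrightarrow> p \<in> bottoms"
  and topsI: "g \<in> D \<Longrightarrow> on_top D g \<Longrightarrow> ct g + 1 = p \<Longrightarrow> p \<in> tops"
  unfolding bottoms_def tops_def by blast+

lemma finite_bottoms: "finite bottoms" and finite_tops: "finite tops"
  using fin by (auto simp: bottoms_def tops_def)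

lemma ct_up: "g \<in> D \<Longrightarrow> ct (fst g - 1, snd g) = ct g + 1"
  using pos[of "fst g" "snd g"] by (simp add: ct_def of_nat_diff)

lemma ct_right: "ct (fst g, snd g + 1) = ct g + 1"
  by (simp add: ct_def)

end

lemma skew_shape_skew:
  assumes "is_partition lam" "is_partition mu" "skew lam mu \<noteq> {}"
  shows "skew_shape (skew lam mu)"
proof
  fix i j i' j' a b
  assume "(i, j) \<in> skew lam mu" "(i', j') \<in> skew lam mu" "i \<le> a" "a \<le> i'" "j \<le> b" "b \<le> j'"
  then show "(a, b) \<in> skew lam mu"
    using prow_antimono[OF assms(1), of a i'] prow_antimono[OF assms(2), of i a] by (auto simp: skew_def)
next
  have "skew lam mu \<subseteq> {1..length lam} \<times> {1..prow lam 1}"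
  proof
    fix g assume "g \<in> skew lam mu"
    then obtain i j where g: "g = (i, j)" "1 \<le> i" "prow mu i < j" "j \<le> prow lam i" by (auto simp: skew_def)
    then have "i \<le> length lam" by (auto simp: prow_def split: if_splits)
    then show "g \<in> {1..length lam} \<times> {1..prow lam 1}"
      using g prow_antimono[OF assms(1), of 1 i] by auto
  qed
  then show "finite (skew lam mu)" by (rule finite_subset) simp
qed (use assms in \<open>auto simp: skew_def\<close>)

lemma skew_shape_ribbon: "is_ribbon t \<Longrightarrow> skew_shape t"
  by (auto simp: is_ribbon_def is_skew_diagram_def edge_connected_def intro!: skew_shape_skew)

locale connected_shape = skew_shape +
  assumes conn: "edge_connected D"
begin

lemma ct_step: "edge_adj u v \<Longrightarrow> ct v \<le> ct u + 1"
  by (auto simp: edge_adj_def ct_def)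

lemma crossing:
  assumes "x \<in> D" "y \<in> D" "ct x \<le> c" "c < ct y"
  obtains u v where "u \<in> D" "v \<in> D" "ct u = c" "ct v = c + 1"
    "v = (fst u - 1, snd u) \<or> v = (fst u, snd u + 1)"
proof -
  obtain u v where uv: "u \<in> D" "v \<in> D" "edge_adj u v" "ct u = c" "ct v = c + 1"
    using edge_connected_crossing[of D x y ct c, OF conn assms ct_step] by auto
  then have "v = (fst u - 1, snd u) \<or> v = (fst u, snd u + 1)"
    by (auto simp: edge_adj_def ct_def prod_eq_iff)
  then show thesis using that uv by blast
qed

lemma ex_content:
  assumes "ct (rhead D) \<le> c" "c \<le> ct (rtail D)"
  shows "\<exists>g\<in>D. ct g = c"
proof (cases "c = ct (rtail D)")
  case False
  then have "c < ct (rtail D)" using assms(2) by simp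
  then obtain u v where "u \<in> D" "v \<in> D" "ct u = c" "ct v = c + 1"
    "v = (fst u - 1, snd u) \<or> v = (fst u, snd u + 1)"
    by (rule crossing[OF rhead_mem rtail_mem assms(1)])
  then show ?thesis by blast
qed (use rtail_mem in auto)

end

locale ribbon = connected_shape +
  assumes no_square: "no_2x2 D"
begin

text \<open>Two cells on one diagonal would by convexity enclose a 2x2 block.\<close>

lemma content_inj:
  assumes "u \<in> D" "v \<in> D" "ct u = ct v"
  shows "u = v"
proof -
  have "fst u \<le> fst v" if "u \<in> D" "v \<in> D" "ct u = ct v" for u v
  proof (rule ccontr)
    obtain i j i' j' where w: "u = (i', j')" "v = (i, j)" by fastforce
    assume "\<not> fst u \<le> fst v"
    then have lt: "i + 1 \<le> i'" "j + 1 \<le> j'" using that w by auto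
    then have "(i + 1, j) \<in> D" "(i, j + 1) \<in> D" "(i + 1, j + 1) \<in> D"
      using convex[of i j i' j' "i + 1" j] convex[of i j i' j' i "j + 1"]
        convex[of i j i' j' "i + 1" "j + 1"] that w by auto
    then show False using no_square that w by (auto simp: no_2x2_def)
  qed
  then show ?thesis using assms by (intro cell_eqI antisym) auto
qed

lemma successor:
  assumes "g \<in> D" "ct g < ct (rtail D)"
  shows "(fst g - 1, snd g) \<in> D \<or> (fst g, snd g + 1) \<in> D"
proof -
  obtain u v where uv: "u \<in> D" "v \<in> D" "ct u = ct g" "ct v = ct g + 1"
    "v = (fst u - 1, snd u) \<or> v = (fst u, snd u + 1)"
    by (rule crossing[OF assms(1) rtail_mem order_refl assms(2)])
  then show ?thesis using content_inj[OF uv(1) assms(1) uv(3)] by auto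
qed

lemma predecessor:
  assumes "g \<in> D" "ct (rhead D) < ct g"
  shows "(fst g + 1, snd g) \<in> D \<or> (fst g, snd g - 1) \<in> D"
proof -
  have "ct (rhead D) \<le> ct g - 1" "ct g - 1 < ct g" using assms(2) by auto
  then obtain u v where uv: "u \<in> D" "v \<in> D" "ct u = ct g - 1" "ct v = ct g - 1 + 1"
    "v = (fst u - 1, snd u) \<or> v = (fst u, snd u + 1)"
    by (rule crossing[OF rhead_mem assms(1)])
  then have v: "v = g" using content_inj[OF uv(2) assms(1)] by simp
  obtain i j where u: "u = (i, j)" by fastforce
  then have "1 \<le> i" using pos uv(1) by auto
  then have "u = (fst v + 1, snd v) \<or> u = (fst v, snd v - 1)" using uv(5) u by auto
  then show ?thesis using uv(1) v by auto
qed

end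

lemma ribbonI: "is_ribbon t \<Longrightarrow> ribbon t"
  unfolding ribbon_def ribbon_axioms_def connected_shape_def connected_shape_axioms_def
  using skew_shape_ribbon by (auto simp: is_ribbon_def)

section \<open>Outer ribbon decompositions\<close>

locale ribbon_decomp = connected_shape +
  fixes Th :: "cell set list"
  assumes decomp: "outer_ribbon_decomp D Th"
begin

lemma
  assumes "t \<in> set Th"
  shows ribbon_Th: "ribbon t" and subset_Th: "t \<subseteq> D"
    and head_outer: "on_left D (rhead t) \<or> on_bottom D (rhead t)"
    and tail_outer: "on_top D (rtail t) \<or> on_right D (rtail t)"
  using assms decomp by (auto simp: outer_ribbon_decomp_def intro: ribbonI)

lemma connected_Th: "t \<in> set Th \<Longrightarrow> connected_shape t"
  using ribbon_Th by (simp add: ribbon_def)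

lemma shape_Th: "t \<in> set Th \<Longrightarrow> skew_shape t"
  using connected_Th by (simp add: connected_shape_def)

text \<open>The function \<open>ct\<close> depends only on the shift, so with \<open>k = k\<close>
  contents inside a ribbon are literally those in \<open>D\<close>.\<close>

lemmas content_inj_Th = ribbon.content_inj[OF ribbon_Th]
  and successor_Th = ribbon.successor[OF ribbon_Th, where k = k]
  and predecessor_Th = ribbon.predecessor[OF ribbon_Th, where k = k]
  and tail_mem = skew_shape.rtail_mem[OF shape_Th]
  and head_mem = skew_shape.rhead_mem[OF shape_Th]
  and tail_max = skew_shape.ct_rtail_max(1)[OF shape_Th, where k = k]
  and head_min = skew_shape.ct_rhead_min(1)[OF shape_Th, where k = k]
  and ex_content_Th = connected_shape.ex_content[OF connected_Th, where k = k]

lemma disjoint_Th: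
  assumes "t \<in> set Th" "t' \<in> set Th" "g \<in> t" "g \<in> t'"
  shows "t = t'"
proof -
  obtain i j where ij: "i < length Th" "t = Th ! i" "j < length Th" "t' = Th ! j"
    using assms(1,2) by (auto simp: in_set_conv_nth)
  have "i = j"
  proof (rule ccontr)
    assume "i \<noteq> j"
    then have "Th ! i \<inter> Th ! j = {}" using ij decomp by (simp add: outer_ribbon_decomp_def)
    then show False using assms ij by auto
  qed
  then show ?thesis using ij by simp
qed

lemma cover_Th:
  assumes "g \<in> D"
  obtains t where "t \<in> set Th" "g \<in> t"
  using assms decomp by (auto simp: outer_ribbon_decomp_def)

lemma distinct_Th: "distinct Th"
proof -
  have "Th ! i \<noteq> Th ! j" if "i < length Th" "j < length Th" "i \<noteq> j" for i j
  proof -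
    have "Th ! i \<inter> Th ! j = {}" using that decomp by (simp add: outer_ribbon_decomp_def)
    moreover have "Th ! i \<noteq> {}" using skew_shape.ne[OF shape_Th] that by simp
    ultimately show ?thesis by auto
  qed
  then show ?thesis by (simp add: distinct_conv_nth)
qed

lemma mem_D: "t \<in> set Th \<Longrightarrow> g \<in> t \<Longrightarrow> g \<in> D"
  using subset_Th by auto

lemma goes_up_iff:
  assumes "t \<in> set Th" "g \<in> t" "g \<noteq> rtail D"
  shows "goes_up D Th g \<longleftrightarrow> (fst g - 1, snd g) \<in> t \<or> (g = rtail t \<and> on_top D g)"
proof -
  have "t' = t" if "t' \<in> set Th" "g \<in> t'" for t'
    by (rule disjoint_Th[OF that(1) assms(1) that(2) assms(2)])
  then have "(\<exists>t'\<in>set Th. g \<in> t' \<and> P t') \<longleftrightarrow> P t" for P using assms(1,2) by blast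
  then show ?thesis using assms(3) by (simp add: goes_up_def)
qed

lemma goes_up_not_right:
  assumes "t \<in> set Th" "g \<in> t" "g \<noteq> rtail D" "goes_up D Th g"
  shows "(fst g, snd g + 1) \<notin> t"
proof
  assume r: "(fst g, snd g + 1) \<in> t"
  have gD: "g \<in> D" using mem_D assms by blast
  show False
  proof (cases "(fst g - 1, snd g) \<in> t")
    case True
    then have "(fst g - 1, snd g) = (fst g, snd g + 1)"
      using r assms by (intro content_inj_Th[of t _ _ k]) (simp_all only: ct_up[OF gD] ct_right)
    then show False by simp
  next
    case False
    then have "g = rtail t" using goes_up_iff assms by blast
    then show False using tail_max[OF assms(1) r] ct_right[of g] by simp
  qed
qed

lemma not_goes_up_right:
  assumes "t \<in> set Th" "g \<in> t" "g \<noteq> rtail D" "\<not> goes_up D Th g"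
  shows "(fst g - 1, snd g) \<notin> t" and "(fst g, snd g + 1) \<in> t \<or> (g = rtail t \<and> on_right D g)"
proof -
  show *: "(fst g - 1, snd g) \<notin> t" using goes_up_iff assms by blast
  show "(fst g, snd g + 1) \<in> t \<or> (g = rtail t \<and> on_right D g)"
  proof (cases "g = rtail t")
    case True
    then show ?thesis using goes_up_iff[OF assms(1-3)] tail_outer[OF assms(1)] assms(4) by blast
  next
    case False
    have "ct g \<noteq> ct (rtail t)" using content_inj_Th[OF assms(1,2) tail_mem[OF assms(1)]] False by blast
    then have "ct g < ct (rtail t)" using tail_max[OF assms(1,2)] by simp
    then show ?thesis using successor_Th[OF assms(1,2)] * by blast
  qed
qed

section \<open>Directions of the cells on one diagonal\<close>

lemma not_rtail: "g \<in> D \<Longrightarrow> h \<in> D \<Longrightarrow> ct g < ct h \<Longrightarrow> g \<noteq> rtail D"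
  by (auto dest: ct_rtail_max(1))

text \<open>The cell \<open>(i, j + 1)\<close> is right of one cell and above the other. If the
  first goes up and the second right, neither enters it, so it heads a ribbon although its left and
  lower neighbours are in \<open>D\<close>; the decomposition would not be outer. If the first goes
  right and the second up, both enter it, and one ribbon meets a diagonal twice.\<close>

lemma goes_up_diagonal:
  assumes "(i, j) \<in> D" "(i + 1, j + 1) \<in> D"
  shows "goes_up D Th (i, j) \<longleftrightarrow> goes_up D Th (i + 1, j + 1)"
proof -
  have w: "(i, j + 1) \<in> D" using convex[OF assms, of i "j + 1"] by simp
  have n1: "(i, j) \<noteq> rtail D" by (rule not_rtail[OF assms(1) w]) simp
  have n2: "(i + 1, j + 1) \<noteq> rtail D" by (rule not_rtail[OF assms(2) w]) simp
  obtain t1 where t1: "t1 \<in> set Th" "(i, j) \<in> t1" using cover_Th[OF assms(1)] .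
  obtain t2 where t2: "t2 \<in> set Th" "(i + 1, j + 1) \<in> t2" using cover_Th[OF assms(2)] .
  obtain t where t: "t \<in> set Th" "(i, j + 1) \<in> t" using cover_Th[OF w] .
  show ?thesis
  proof
    assume up: "goes_up D Th (i, j)"
    show "goes_up D Th (i + 1, j + 1)"
    proof (rule ccontr)
      assume up': "\<not> goes_up D Th (i + 1, j + 1)"
      have "(i, j) \<notin> t" using goes_up_not_right[OF t1 n1 up] disjoint_Th[OF t1(1) t(1) t1(2)] t by auto
      moreover have "(i + 1, j + 1) \<notin> t"
        using not_goes_up_right(1)[OF t2 n2 up'] disjoint_Th[OF t2(1) t(1) t2(2)] t by auto
      ultimately have "\<not> ct (rhead t) < ct (i, j + 1)" using predecessor_Th[OF t] by auto
      then have "rhead t = (i, j + 1)"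
        using head_min[OF t] content_inj_Th[OF t(1) head_mem[OF t(1)] t(2), where k = k] by simp
      then show False using head_outer[OF t(1)] assms by (auto simp: on_left_def on_bottom_def)
    qed
  next
    assume up': "goes_up D Th (i + 1, j + 1)"
    show "goes_up D Th (i, j)"
    proof (rule ccontr)
      assume up: "\<not> goes_up D Th (i, j)"
      have 1: "(i, j + 1) \<in> t1" using not_goes_up_right(2)[OF t1 n1 up] w by (auto simp: on_right_def)
      have "(i, j + 1) \<in> t2" using up' w unfolding goes_up_iff[OF t2 n2] by (auto simp: on_top_def)
      then have "t1 = t2" using disjoint_Th[OF t1(1) t2(1) 1] by simp
      then show False using content_inj_Th[OF t1(1) t1(2), of "(i + 1, j + 1)" k] t2 by simp
    qed
  qed
qed

text \<open>By convexity a diagonal has no gaps, so the comparison of neighbours propagates. It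
  makes \<open>content_up\<close> independent of the chosen cell.\<close>

lemma goes_up_same_content:
  assumes "g \<in> D" "h \<in> D" "ct g = ct h"
  shows "goes_up D Th g \<longleftrightarrow> goes_up D Th h"
proof -
  have *: "goes_up D Th (i, j) \<longleftrightarrow> goes_up D Th (i + n, j + n)" if "(i, j) \<in> D" "(i + n, j + n) \<in> D" for i j n
    using that(2)
  proof (induction n)
    case (Suc n)
    then have m: "(i + n, j + n) \<in> D" using convex[OF that(1) Suc.prems, of "i + n" "j + n"] by simp
    then show ?case using Suc goes_up_diagonal[of "i + n" "j + n"] by simp
  qed simp
  obtain i j i' j' where g: "g = (i, j)" "h = (i', j')" by fastforce
  show ?thesis
  proof (cases "i \<le> i'")
    case True
    then have "i' = i + (i' - i)" "j' = j + (i' - i)" using assms(3) g by auto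
    then show ?thesis using *[of i j "i' - i"] assms g by metis
  next
    case False
    then have "i = i' + (i - i')" "j = j' + (i - i')" using assms(3) g by auto
    then show ?thesis using *[of i' j' "i - i'"] assms g by metis
  qed
qed

lemma content_up_iff: "g \<in> D \<Longrightarrow> content_up D Th ct (ct g) \<longleftrightarrow> goes_up D Th g"
  unfolding content_up_def using goes_up_same_content by blast

text \<open>The label is \<open>c + 1\<close> because a right step at \<open>c\<close> makes
  \<open>c + 1\<close> the bottom of a new column of the cutting strip. The last content is
  excluded, since no step leaves it.\<close>

definition turns :: "int set" where
  "turns = {c + 1 | c. ct (rhead D) \<le> c \<and> c < ct (rtail D) \<and> \<not> content_up D Th ct c}"

lemma finite_turns: "finite turns"
proof -
  have "turns \<subseteq> {ct (rhead D)..ct (rtail D)}" by (auto simp: turns_def)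
  then show ?thesis by (rule finite_subset) simp
qed

lemma turns_iff: "c + 1 \<in> turns \<longleftrightarrow> ct (rhead D) \<le> c \<and> c < ct (rtail D) \<and> \<not> content_up D Th ct c"
  by (auto simp: turns_def)

lemma turns_step:
  assumes "g \<in> D" "h \<in> D" "ct h = ct g + 1"
  shows "ct g + 1 \<in> turns \<longleftrightarrow> \<not> goes_up D Th g" and "g \<noteq> rtail D"
proof -
  show "g \<noteq> rtail D" using not_rtail[OF assms(1,2)] assms(3) by simp
  show "ct g + 1 \<in> turns \<longleftrightarrow> \<not> goes_up D Th g"
    unfolding turns_iff content_up_iff[OF assms(1)]
    using ct_rhead_min(1)[OF assms(1)] ct_rtail_max(1)[OF assms(2)] assms(3) by auto
qed

text \<open>Otherwise the cell below the head is in \<open>D\<close> and, the label of the head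
  being no turn, goes up into the head, which then is not the first cell of its ribbon. The left
  perimeter is treated alike; for tails, the ribbon would run on past its tail.\<close>

lemma head_on_bottom:
  assumes "t \<in> set Th" "ct (rhead t) \<notin> turns"
  shows "on_bottom D (rhead t)"
proof (rule ccontr)
  let ?h = "rhead t"
  assume "\<not> on_bottom D ?h"
  then have x: "(fst ?h + 1, snd ?h) \<in> D" by (simp add: on_bottom_def)
  have h: "?h \<in> t" "?h \<in> D" using head_mem mem_D assms by blast+
  have c: "ct ?h = ct (fst ?h + 1, snd ?h) + 1" by (simp add: ct_def)
  from turns_step[OF x h(2) c] assms(2) c
  have up: "goes_up D Th (fst ?h + 1, snd ?h)" "(fst ?h + 1, snd ?h) \<noteq> rtail D" by auto
  obtain t' where t': "t' \<in> set Th" "(fst ?h + 1, snd ?h) \<in> t'" using cover_Th[OF x] .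
  have "?h \<in> t'" using up(1) h(2) unfolding goes_up_iff[OF t' up(2)] by (auto simp: on_top_def)
  then have "t' = t" using disjoint_Th[OF t'(1) assms(1)] h by auto
  then show False using head_min[OF assms(1), of "(fst ?h + 1, snd ?h)"] t' c by simp
qed

lemma head_on_left:
  assumes "t \<in> set Th" "ct (rhead t) \<in> turns"
  shows "on_left D (rhead t)"
proof (rule ccontr)
  let ?h = "rhead t"
  assume "\<not> on_left D ?h"
  then have x: "(fst ?h, snd ?h - 1) \<in> D" by (simp add: on_left_def)
  have h: "?h \<in> t" "?h \<in> D" using head_mem mem_D assms by blast+
  have s: "snd ?h - 1 + 1 = snd ?h" using pos[of "fst ?h" "snd ?h"] h(2) by simp
  have c: "ct ?h = ct (fst ?h, snd ?h - 1) + 1"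
    using ct_right[of "(fst ?h, snd ?h - 1)"] s by simp
  from turns_step[OF x h(2) c] assms(2) c
  have up: "\<not> goes_up D Th (fst ?h, snd ?h - 1)" "(fst ?h, snd ?h - 1) \<noteq> rtail D" by auto
  obtain t' where t': "t' \<in> set Th" "(fst ?h, snd ?h - 1) \<in> t'" using cover_Th[OF x] .
  have "?h \<in> t'" using not_goes_up_right(2)[OF t' up(2,1)] h(2) s by (auto simp: on_right_def)
  then have "t' = t" using disjoint_Th[OF t'(1) assms(1)] h by auto
  then show False using head_min[OF assms(1), of "(fst ?h, snd ?h - 1)"] t' c by simp
qed

lemma tail_on_top:
  assumes "t \<in> set Th" "ct (rtail t) + 1 \<notin> turns"
  shows "on_top D (rtail t)"
proof (rule ccontr)
  let ?x = "rtail t"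
  assume "\<not> on_top D ?x"
  then have u: "(fst ?x - 1, snd ?x) \<in> D" by (simp add: on_top_def)
  have x: "?x \<in> t" "?x \<in> D" using tail_mem mem_D assms by blast+
  from turns_step[OF x(2) u ct_up[OF x(2)]] assms(2) have "goes_up D Th ?x" "?x \<noteq> rtail D" by auto
  then have "(fst ?x - 1, snd ?x) \<in> t" using \<open>\<not> on_top D ?x\<close> goes_up_iff[OF assms(1) x(1)] by blast
  from tail_max[OF assms(1) this] show False using ct_up[OF x(2)] by simp
qed

lemma tail_on_right:
  assumes "t \<in> set Th" "ct (rtail t) + 1 \<in> turns"
  shows "on_right D (rtail t)"
proof (rule ccontr)
  let ?x = "rtail t"
  assume "\<not> on_right D ?x"
  then have u: "(fst ?x, snd ?x + 1) \<in> D" by (simp add: on_right_def)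
  have x: "?x \<in> t" "?x \<in> D" using tail_mem mem_D assms by blast+
  from turns_step[OF x(2) u ct_right] assms(2) have "\<not> goes_up D Th ?x" "?x \<noteq> rtail D" by auto
  then have "(fst ?x, snd ?x + 1) \<in> t" using \<open>\<not> on_right D ?x\<close> not_goes_up_right(2)[OF assms(1) x(1)] by blast
  from tail_max[OF assms(1) this] show False using ct_right[of ?x] by simp
qed

definition head_ct :: "cell set \<Rightarrow> int" where "head_ct t = ct (rhead t)"
definition tail_ct :: "cell set \<Rightarrow> int" where "tail_ct t = ct (rtail t) + 1"

text \<open>A head at a turn is on the left perimeter, which excludes \<open>tops\<close>.
  Conversely, a label outside the turns is realised by the bottom cell of a column, which its left
  neighbour does not enter; for a turn, the highest cell of the diagonal has no predecessor.\<close>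

lemma heads_eq: "head_ct ` set Th = (bottoms - turns) \<union> (turns - tops)"
proof (intro equalityI subsetI)
  fix p assume "p \<in> head_ct ` set Th"
  then obtain t where t: "t \<in> set Th" "p = ct (rhead t)" by (auto simp: head_ct_def)
  have h: "rhead t \<in> D" using t head_mem mem_D by blast
  show "p \<in> (bottoms - turns) \<union> (turns - tops)"
  proof (cases "p \<in> turns")
    case True
    have "p \<notin> tops"
    proof
      assume "p \<in> tops"
      then obtain x where x: "x \<in> D" "on_top D x" "ct x + 1 = p" by (auto simp: tops_def)
      have "on_left D (rhead t)" using head_on_left[OF t(1)] True unfolding t(2) .
      then show False by (rule not_on_top_on_left[OF x(1,2) h]) (simp only: x(3) t(2))
    qed
    then show ?thesis using True by simp
  next
    case False
    then have "on_bottom D (rhead t)" using head_on_bottom t by simp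
    then show ?thesis using False t h by (auto simp: bottoms_def)
  qed
next
  fix p assume p: "p \<in> (bottoms - turns) \<union> (turns - tops)"
  have head: "p \<in> head_ct ` set Th"
    if w: "w \<in> D" "ct w = p" and no_pred: "\<And>t. t \<in> set Th \<Longrightarrow> w \<in> t \<Longrightarrow> (fst w + 1, snd w) \<notin> t \<and> (fst w, snd w - 1) \<notin> t" for w
  proof -
    obtain t where t: "t \<in> set Th" "w \<in> t" using cover_Th[OF w(1)] .
    then have "\<not> ct (rhead t) < ct w" using predecessor_Th[OF t] no_pred[OF t] by blast
    then have "ct (rhead t) = p" using head_min[OF t] w(2) by simp
    then show ?thesis using t by (auto simp: head_ct_def)
  qed
  show "p \<in> head_ct ` set Th"
  proof (cases "p \<in> turns")
    case False
    then obtain w where w: "w \<in> D" "on_bottom D w" "ct w = p" using p by (auto simp: bottoms_def)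
    show ?thesis
    proof (rule head[OF w(1,3)])
      fix t assume t: "t \<in> set Th" "w \<in> t"
      have "(fst w, snd w - 1) \<notin> t"
      proof
        assume x: "(fst w, snd w - 1) \<in> t"
        have s: "snd w - 1 + 1 = snd w" using pos[of "fst w" "snd w"] w(1) by simp
        have c: "ct w = ct (fst w, snd w - 1) + 1"
          using ct_right[of "(fst w, snd w - 1)"] s by simp
        have "goes_up D Th (fst w, snd w - 1)" "(fst w, snd w - 1) \<noteq> rtail D"
          using turns_step[OF mem_D[OF t(1) x] w(1) c] False w(3) c by auto
        from goes_up_not_right[OF t(1) x this(2,1)] show False using s t by simp
      qed
      then show "(fst w + 1, snd w) \<notin> t \<and> (fst w, snd w - 1) \<notin> t"
        using w(2) mem_D[OF t(1)] by (auto simp: on_bottom_def)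
    qed
  next
    case True
    then have p': "ct (rhead D) \<le> p - 1" "p - 1 < ct (rtail D)" "p \<notin> tops"
      using p turns_iff[of "p - 1"] by auto
    then obtain w0 where w0: "w0 \<in> D" "ct w0 = p" using ex_content[of p] by auto
    obtain w where "w \<in> D \<and> ct w = p" "\<forall>u. u \<in> D \<and> ct u = p \<longrightarrow> fst w \<le> fst u"
      using ex_has_least_nat[of "\<lambda>u. u \<in> D \<and> ct u = p" w0 fst] w0 by blast
    then have w: "w \<in> D" "ct w = p" and least: "\<And>u. u \<in> D \<Longrightarrow> ct u = p \<Longrightarrow> fst w \<le> fst u"
      by blast+
    have s: "snd w - 1 + 1 = snd w" using pos[of "fst w" "snd w"] w(1) by simp
    \<comment> \<open>If the left neighbour were in \<open>D\<close>, then, \<open>p\<close> not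
      being in \<open>tops\<close>, the cell above it would be too, and that is a higher cell on the
      diagonal of \<open>w\<close>.\<close>
    have left: "(fst w, snd w - 1) \<notin> D"
    proof
      assume x: "(fst w, snd w - 1) \<in> D"
      have "ct (fst w, snd w - 1) + 1 = p" using ct_right[of "(fst w, snd w - 1)"] s w(2) by simp
      then have "\<not> on_top D (fst w, snd w - 1)" using p'(3) topsI[OF x] by blast
      then have u: "(fst w - 1, snd w - 1) \<in> D" by (simp add: on_top_def)
      have "1 \<le> fst w" using pos x by auto
      moreover from this have "ct (fst w - 1, snd w - 1) = p"
        using w(2) s by (auto simp: ct_def of_nat_diff)
      ultimately show False using least[OF u] by simp
    qed
    show ?thesis
    proof (rule head[OF w])
      fix t assume t: "t \<in> set Th" "w \<in> t"
      have "(fst w + 1, snd w) \<notin> t"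
      proof
        assume x: "(fst w + 1, snd w) \<in> t"
        have c: "ct w = ct (fst w + 1, snd w) + 1" by (simp add: ct_def)
        have "\<not> goes_up D Th (fst w + 1, snd w)" "(fst w + 1, snd w) \<noteq> rtail D"
          using turns_step[OF mem_D[OF t(1) x] w(1) c] True w(2) c by auto
        from not_goes_up_right(1)[OF t(1) x this(2,1)] show False using t by simp
      qed
      then show "(fst w + 1, snd w) \<notin> t \<and> (fst w, snd w - 1) \<notin> t"
        using left mem_D[OF t(1)] by auto
    qed
  qed
qed

text \<open>The mirror image of \<open>heads_eq\<close>: tails at turns are on the right perimeter,
  and for a turn the converse uses the lowest cell of the diagonal \<open>p - 1\<close>.\<close>

lemma tails_eq: "tail_ct ` set Th = (tops - turns) \<union> (turns - bottoms)"
proof (intro equalityI subsetI)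
  fix p assume "p \<in> tail_ct ` set Th"
  then obtain t where t: "t \<in> set Th" "p = ct (rtail t) + 1" by (auto simp: tail_ct_def)
  have x: "rtail t \<in> D" using t tail_mem mem_D by blast
  show "p \<in> (tops - turns) \<union> (turns - bottoms)"
  proof (cases "p \<in> turns")
    case True
    have "p \<notin> bottoms"
    proof
      assume "p \<in> bottoms"
      then obtain w where w: "w \<in> D" "on_bottom D w" "ct w = p" by (auto simp: bottoms_def)
      have "on_right D (rtail t)" using tail_on_right[OF t(1)] True unfolding t(2) .
      then show False by (rule not_on_right_on_bottom[OF x _ w(1,2)]) (simp only: w(3) t(2))
    qed
    then show ?thesis using True by simp
  next
    case False
    then have "on_top D (rtail t)" using tail_on_top t by simp
    then show ?thesis using False t x by (auto simp: tops_def)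
  qed
next
  fix p assume p: "p \<in> (tops - turns) \<union> (turns - bottoms)"
  have tail: "p \<in> tail_ct ` set Th"
    if x: "x \<in> D" "ct x + 1 = p" and no_succ: "\<And>t. t \<in> set Th \<Longrightarrow> x \<in> t \<Longrightarrow> (fst x - 1, snd x) \<notin> t \<and> (fst x, snd x + 1) \<notin> t" for x
  proof -
    obtain t where t: "t \<in> set Th" "x \<in> t" using cover_Th[OF x(1)] .
    then have "\<not> ct x < ct (rtail t)" using successor_Th[OF t] no_succ[OF t] by blast
    then have "ct (rtail t) + 1 = p" using tail_max[OF t] x(2) by simp
    then show ?thesis using t by (auto simp: tail_ct_def)
  qed
  show "p \<in> tail_ct ` set Th"
  proof (cases "p \<in> turns")
    case False
    then obtain x where x: "x \<in> D" "on_top D x" "ct x + 1 = p" using p by (auto simp: tops_def)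
    show ?thesis
    proof (rule tail[OF x(1,3)])
      fix t assume t: "t \<in> set Th" "x \<in> t"
      have "(fst x, snd x + 1) \<notin> t"
      proof
        assume r: "(fst x, snd x + 1) \<in> t"
        have "goes_up D Th x" "x \<noteq> rtail D"
          using turns_step[OF x(1) mem_D[OF t(1) r] ct_right] False x(3) by auto
        from goes_up_not_right[OF t this(2,1)] show False using r by simp
      qed
      then show "(fst x - 1, snd x) \<notin> t \<and> (fst x, snd x + 1) \<notin> t"
        using x(2) mem_D[OF t(1)] by (auto simp: on_top_def)
    qed
  next
    case True
    then have p': "ct (rhead D) \<le> p - 1" "p - 1 < ct (rtail D)" "p \<notin> bottoms"
      using p turns_iff[of "p - 1"] by auto
    then obtain x0 where x0: "x0 \<in> D" "ct x0 = p - 1" using ex_content[of "p - 1"] by auto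
    define S where "S = fst ` {u \<in> D. ct u = p - 1}"
    have S: "finite S" "S \<noteq> {}" using fin x0 unfolding S_def by (simp, blast)
    from Max_in[OF this] obtain x where x: "x \<in> D" "ct x = p - 1" and m: "Max S = fst x"
      by (auto simp: S_def)
    have right: "(fst x, snd x + 1) \<notin> D"
    proof
      assume w: "(fst x, snd x + 1) \<in> D"
      have "ct (fst x, snd x + 1) = p" using ct_right[of x] x(2) by simp
      then have "\<not> on_bottom D (fst x, snd x + 1)" using p'(3) bottomsI[OF w] by blast
      then have "(fst x + 1, snd x + 1) \<in> D" by (simp add: on_bottom_def)
      moreover have "ct (fst x + 1, snd x + 1) = p - 1" using x(2) by (simp add: ct_def)
      ultimately show False using Max_ge[OF S(1), of "fst x + 1"] unfolding m by (force simp: S_def)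
    qed
    show ?thesis
    proof (rule tail[OF x(1)])
      fix t assume t: "t \<in> set Th" "x \<in> t"
      have "(fst x - 1, snd x) \<notin> t"
      proof
        assume u: "(fst x - 1, snd x) \<in> t"
        have "\<not> goes_up D Th x" "x \<noteq> rtail D"
          using turns_step[OF x(1) mem_D[OF t(1) u] ct_up[OF x(1)]] True x(2) by auto
        from not_goes_up_right(1)[OF t this(2,1)] show False using u by simp
      qed
      then show "(fst x - 1, snd x) \<notin> t \<and> (fst x, snd x + 1) \<notin> t"
        using right mem_D[OF t(1)] by auto
    qed (use x in simp)
  qed
qed

text \<open>Whether the common label is a turn decides on which perimeter both heads lie, hence
  whether both are the first or both the last cell of their diagonal.\<close>

lemma inj_on_head_ct: "inj_on head_ct (set Th)"
proof (rule inj_onI)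
  fix t t' assume t: "t \<in> set Th" "t' \<in> set Th" and eq: "head_ct t = head_ct t'"
  have h: "rhead t \<in> D" "rhead t' \<in> D" "rhead t \<in> t" "rhead t' \<in> t'" using t head_mem mem_D by blast+
  have c: "ct (rhead t) = ct (rhead t')" using eq by (simp add: head_ct_def)
  have "fst (rhead t) = fst (rhead t')"
  proof (cases "ct (rhead t) \<in> turns")
    case True
    have "ct (rhead t') \<in> turns" using True unfolding c .
    from on_left_min[OF h(1) head_on_left[OF t(1) True] h(2) c[symmetric]] on_left_min[OF h(2) head_on_left[OF t(2) this] h(1) c]
    show ?thesis by simp
  next
    case False
    have "ct (rhead t') \<notin> turns" using False unfolding c .
    from on_bottom_max[OF h(1) head_on_bottom[OF t(1) False] h(2) c[symmetric]] on_bottom_max[OF h(2) head_on_bottom[OF t(2) this] h(1) c]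
    show ?thesis by simp
  qed
  then have "rhead t = rhead t'" using cell_eqI[OF c] by simp
  then show "t = t'" using disjoint_Th[OF t] h by metis
qed

lemma inj_on_tail_ct: "inj_on tail_ct (set Th)"
proof (rule inj_onI)
  fix t t' assume t: "t \<in> set Th" "t' \<in> set Th" and eq: "tail_ct t = tail_ct t'"
  have h: "rtail t \<in> D" "rtail t' \<in> D" "rtail t \<in> t" "rtail t' \<in> t'" using t tail_mem mem_D by blast+
  have c: "ct (rtail t) = ct (rtail t')" using eq by (simp add: tail_ct_def)
  have "fst (rtail t) = fst (rtail t')"
  proof (cases "ct (rtail t) + 1 \<in> turns")
    case True
    have "ct (rtail t') + 1 \<in> turns" using True unfolding c .
    from on_right_max[OF h(1) tail_on_right[OF t(1) True] h(2) c[symmetric]] on_right_max[OF h(2) tail_on_right[OF t(2) this] h(1) c]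
    show ?thesis by simp
  next
    case False
    have "ct (rtail t') + 1 \<notin> turns" using False unfolding c .
    from on_top_min[OF h(1) tail_on_top[OF t(1) False] h(2) c[symmetric]] on_top_min[OF h(2) tail_on_top[OF t(2) this] h(1) c]
    show ?thesis by simp
  qed
  then have "rtail t = rtail t'" using cell_eqI[OF c] by simp
  then show "t = t'" using disjoint_Th[OF t] h by metis
qed

section \<open>Relative position of two ribbons\<close>

lemma head_le_tail:
  assumes "t \<in> set Th"
  shows "head_ct t \<le> tail_ct t"
  using head_min[OF assms tail_mem[OF assms]] by (simp add: head_ct_def tail_ct_def)

lemma step_Th:
  assumes "t \<in> set Th" "u \<in> t" "u' \<in> t" "ct u' = ct u + 1"
  shows "u' = (if ct u + 1 \<in> turns then (fst u, snd u + 1) else (fst u - 1, snd u))"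
proof -
  have uD: "u \<in> D" "u' \<in> D" using assms mem_D by blast+
  have "ct u < ct (rtail t)" using tail_max[OF assms(1,3)] assms(4) by simp
  then have ne: "u \<noteq> rtail t" and succ: "(fst u - 1, snd u) \<in> t \<or> (fst u, snd u + 1) \<in> t"
    using successor_Th[OF assms(1,2)] by auto
  note T = turns_step[OF uD assms(4)]
  show ?thesis
  proof (cases "ct u + 1 \<in> turns")
    case True
    then have "(fst u, snd u + 1) \<in> t" using not_goes_up_right(1)[OF assms(1,2) T(2)] T succ by blast
    then have "u' = (fst u, snd u + 1)"
      by (intro content_inj_Th[OF assms(1,3), of _ k]) (simp_all only: assms(4) ct_right)
    then show ?thesis using True by simp
  next
    case False
    then have "(fst u - 1, snd u) \<in> t" using goes_up_not_right[OF assms(1,2) T(2)] T succ by blast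
    then have "u' = (fst u - 1, snd u)"
      by (intro content_inj_Th[OF assms(1,3), of _ k]) (simp_all only: assms(4) ct_up[OF uD(1)])
    then show ?thesis using False by simp
  qed
qed

text \<open>Hence two ribbons keep their relative position on all diagonals that both of them meet.\<close>

lemma parallel:
  assumes t: "t \<in> set Th" "t' \<in> set Th"
    and u: "u \<in> t" "v \<in> t'" "ct u = ct v" and u': "u' \<in> t" "v' \<in> t'" "ct u' = ct v'"
    and le: "ct u \<le> ct u'"
  shows "int (fst u') - int (fst v') = int (fst u) - int (fst v)"
proof -
  have "\<forall>u' v'. u' \<in> t \<longrightarrow> v' \<in> t' \<longrightarrow> ct u' = c \<longrightarrow> ct v' = c \<longrightarrow>
      int (fst u') - int (fst v') = int (fst u) - int (fst v)" if "ct u \<le> c" for c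
    using that
  proof (induction c rule: int_ge_induct)
    case base
    show ?case
    proof (intro allI impI)
      fix u1 v1 assume 1: "u1 \<in> t" "v1 \<in> t'" "ct u1 = ct u" "ct v1 = ct u"
      have "u1 = u" by (rule content_inj_Th[OF t(1) 1(1) u(1) 1(3)])
      moreover have "v1 = v" by (rule content_inj_Th[OF t(2) 1(2) u(2)]) (use 1 u in simp)
      ultimately show "int (fst u1) - int (fst v1) = int (fst u) - int (fst v)" by simp
    qed
  next
    case (step c)
    show ?case
    proof (intro allI impI)
      fix u1 v1 assume 1: "u1 \<in> t" "v1 \<in> t'" "ct u1 = c + 1" "ct v1 = c + 1"
      have "ct (rhead t) \<le> c" "c \<le> ct (rtail t)" "ct (rhead t') \<le> c" "c \<le> ct (rtail t')"
        using head_min[OF t(1) u(1)] head_min[OF t(2) u(2)] tail_max[OF t(1) 1(1)] tail_max[OF t(2) 1(2)]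
          1 step.hyps u(3) by auto
      then obtain u0 v0 where 0: "u0 \<in> t" "v0 \<in> t'" "ct u0 = c" "ct v0 = c"
        using ex_content_Th[OF t(1), of c] ex_content_Th[OF t(2), of c] by auto
      have "1 \<le> fst u0" "1 \<le> fst v0"
        using pos[of "fst u0" "snd u0"] pos[of "fst v0" "snd v0"] mem_D[OF t(1) 0(1)] mem_D[OF t(2) 0(2)] by auto
      moreover have "int (fst u0) - int (fst v0) = int (fst u) - int (fst v)"
        using step.IH 0 by blast
      ultimately show "int (fst u1) - int (fst v1) = int (fst u) - int (fst v)"
        using step_Th[OF t(1) 0(1) 1(1)] step_Th[OF t(2) 0(2) 1(2)] 0 1 by (simp add: of_nat_diff)
    qed
  qed
  then show ?thesis using le u' by metis
qed

text \<open>On the diagonal of its head, \<open>t'\<close> is above \<open>t\<close> if that label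
  is a turn (left perimeter) and below it otherwise (bottom perimeter). On the diagonal where the
  first of the two ribbons ends, a turn puts that ribbon below the other. By \<open>parallel\<close>
  the positions agree, which is the condition \<open>nest\<close> of
  \<open>invs_pairing\<close>.\<close>

lemma nesting:
  assumes t: "t \<in> set Th" "t' \<in> set Th" and lt: "head_ct t < head_ct t'" "head_ct t' < tail_ct t"
  shows "head_ct t' \<in> turns \<longleftrightarrow> (if tail_ct t < tail_ct t' then tail_ct t \<in> turns else tail_ct t' \<notin> turns)"
proof -
  have neq: "t \<noteq> t'" using lt by auto
  then have ne_tail: "tail_ct t \<noteq> tail_ct t'" using inj_on_tail_ct t by (auto dest: inj_onD)
  let ?v = "rhead t'"
  have v: "?v \<in> t'" "?v \<in> D" using head_mem mem_D t by blast+
  obtain u where u: "u \<in> t" "ct u = ct ?v"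
    using ex_content_Th[OF t(1), of "ct ?v"] lt by (auto simp: head_ct_def tail_ct_def)
  have uD: "u \<in> D" using mem_D t u by blast
  have distinct_rows: "fst u \<noteq> fst v" if "u \<in> t" "v \<in> t'" "ct u = ct v" for u v
    using cell_eqI[OF that(3)] disjoint_Th[OF t, of u] that neq by auto
  have 1: "head_ct t' \<in> turns \<longleftrightarrow> fst ?v < fst u"
  proof (cases "head_ct t' \<in> turns")
    case True
    then have "fst ?v \<le> fst u" using on_left_min[OF v(2) head_on_left[OF t(2)] uD] u by (simp add: head_ct_def)
    then show ?thesis using True distinct_rows[OF u(1) v(1) u(2)] by simp
  next
    case False
    then have "fst u \<le> fst ?v" using on_bottom_max[OF v(2) head_on_bottom[OF t(2)] uD] u by (simp add: head_ct_def)
    then show ?thesis using False by simp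
  qed
  show ?thesis
  proof (cases "tail_ct t < tail_ct t'")
    case True
    let ?x = "rtail t"
    have x: "?x \<in> t" "?x \<in> D" using tail_mem mem_D t by blast+
    have "ct ?v \<le> ct ?x" using lt by (simp add: head_ct_def tail_ct_def)
    then obtain y where y: "y \<in> t'" "ct ?x = ct y"
      using ex_content_Th[OF t(2), of "ct ?x"] True by (auto simp: tail_ct_def)
    have yD: "y \<in> D" using mem_D t y by blast
    have par: "int (fst ?x) - int (fst y) = int (fst u) - int (fst ?v)"
      by (rule parallel[OF t u(1) v(1) u(2) x(1) y]) (use u \<open>ct ?v \<le> ct ?x\<close> in simp)
    have "tail_ct t \<in> turns \<longleftrightarrow> fst y < fst ?x"
    proof (cases "tail_ct t \<in> turns")
      case True
      then have "ct ?x + 1 \<in> turns" by (simp add: tail_ct_def)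
      from on_right_max[OF x(2) tail_on_right[OF t(1) this] yD y(2)[symmetric]] have "fst y \<le> fst ?x" .
      then show ?thesis using True distinct_rows[OF x(1) y] by simp
    next
      case False
      then have "ct ?x + 1 \<notin> turns" by (simp add: tail_ct_def)
      from on_top_min[OF x(2) tail_on_top[OF t(1) this] yD y(2)[symmetric]] have "fst ?x \<le> fst y" .
      then show ?thesis using False by simp
    qed
    then show ?thesis using 1 True par by auto
  next
    case False
    let ?y = "rtail t'"
    have y: "?y \<in> t'" "?y \<in> D" using tail_mem mem_D t by blast+
    have "ct ?v \<le> ct ?y" using head_min[OF t(2) y(1)] .
    then obtain x where x: "x \<in> t" "ct x = ct ?y"
      using ex_content_Th[OF t(1), of "ct ?y"] False ne_tail lt by (auto simp: tail_ct_def head_ct_def)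
    have xD: "x \<in> D" using mem_D t x by blast
    have par: "int (fst x) - int (fst ?y) = int (fst u) - int (fst ?v)"
      by (rule parallel[OF t u(1) v(1) u(2) x(1) y(1) x(2)]) (use u x \<open>ct ?v \<le> ct ?y\<close> in simp)
    have "tail_ct t' \<in> turns \<longleftrightarrow> fst x < fst ?y"
    proof (cases "tail_ct t' \<in> turns")
      case True
      then have "ct ?y + 1 \<in> turns" by (simp add: tail_ct_def)
      from on_right_max[OF y(2) tail_on_right[OF t(2) this] xD x(2)] have "fst x \<le> fst ?y" .
      then show ?thesis using True distinct_rows[OF x(1) y(1) x(2)] by simp
    next
      case False
      then have "ct ?y + 1 \<notin> turns" by (simp add: tail_ct_def)
      from on_top_min[OF y(2) tail_on_top[OF t(2) this] xD x(2)] have "fst ?y \<le> fst x" .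
      then show ?thesis using False by simp
    qed
    then show ?thesis using 1 False par distinct_rows[OF x(1) y(1) x(2)] by auto
  qed
qed

end

section \<open>Flagged skew shapes\<close>

lemma rcontent_eq_ct:
  "rcontent lam r = skew_shape.ct (r - 1 + int (pconj lam 1))" if "skew_shape D"
  by (rule ext) (simp add: rcontent_def skew_shape.ct_def[OF that])

locale flagged_shape =
  fixes lam mu :: "nat list" and r k :: int
  assumes k: "k = r - 1 + int (pconj lam 1)" and lam: "is_partition lam" and mu: "is_partition mu" and sub: "subpart mu lam"
    and conn: "edge_connected (skew lam mu)"
begin

abbreviation D where "D \<equiv> skew lam mu"
abbreviation cont where "cont \<equiv> rcontent lam r"

sublocale connected_shape D k
proof -
  interpret skew_shape D
    by (rule skew_shape_skew) (use lam mu conn in \<open>auto simp: edge_connected_def\<close>)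
  show "connected_shape D" by unfold_locales (rule conn)
qed

lemma cont_eq: "cont = ct"
  unfolding k by (rule rcontent_eq_ct[OF skew_shape_axioms])

lemma mem_skew: "(i, j) \<in> D \<longleftrightarrow> 1 \<le> j \<and> pconj mu j < i \<and> i \<le> pconj lam j"
  by (rule mem_skew_iff[OF lam mu])

text \<open>The diagram need not start in column 1, as \<open>mu\<close> may cover whole columns of
  \<open>lam\<close>, and the flags may be longer than \<open>lam\<close> is wide; cells occur only
  between these two bounds.\<close>

definition first_col where "first_col = Min (snd ` D)"
definition last_col where "last_col = Max (snd ` D)"

lemma column_bounds:
  assumes "(i, j) \<in> D"
  shows "first_col \<le> j" "j \<le> last_col" "1 \<le> first_col"
proof -
  have "finite (snd ` D)" "snd ` D \<noteq> {}" using fin ne by auto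
  then have "first_col \<in> snd ` D" unfolding first_col_def by (rule Min_in)
  then show "1 \<le> first_col" using pos by auto
  have "j \<in> snd ` D" using assms by force
  then show "first_col \<le> j" "j \<le> last_col"
    unfolding first_col_def last_col_def using \<open>finite (snd ` D)\<close> by auto
qed

lemma first_le_last: "1 \<le> first_col" "first_col \<le> last_col"
  using ne column_bounds by (force intro: order.trans)+

lemma last_col_le: "last_col \<le> prow lam 1"
proof -
  have "finite (snd ` D)" "snd ` D \<noteq> {}" using fin ne by auto
  then have "last_col \<in> snd ` D" unfolding last_col_def by (rule Max_in)
  then obtain i where "(i, last_col) \<in> D" by auto
  then have "1 \<le> i" "last_col \<le> prow lam i" by (auto simp: skew_def)
  then show ?thesis using prow_antimono[OF lam, of 1 i] by simp
qed

text \<open>A connected shape skips no column: the crossing lemma is applied to the column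
  number.\<close>

lemma nonempty_column:
  assumes "first_col \<le> j" "j \<le> last_col"
  shows "pconj mu j < pconj lam j"
proof -
  have "finite (snd ` D)" "snd ` D \<noteq> {}" using fin ne by auto
  then have "first_col \<in> snd ` D" "last_col \<in> snd ` D"
    unfolding first_col_def last_col_def by (auto intro: Min_in Max_in)
  then obtain x y where xy: "x \<in> D" "y \<in> D" "snd x = first_col" "snd y = last_col" by auto
  have "\<exists>u\<in>D. snd u = j"
  proof (cases "j = last_col")
    case False
    have "\<exists>u\<in>D. \<exists>v\<in>D. edge_adj u v \<and> int (snd u) = int j \<and> int (snd v) = int j + 1"
      by (rule edge_connected_crossing[OF conn xy(1,2)])
        (use xy assms False in \<open>auto simp: edge_adj_def\<close>)
    then show ?thesis by auto
  qed (use xy in auto)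
  then obtain i where "(i, j) \<in> D" by auto
  then show ?thesis by (simp add: mem_skew)
qed

lemma empty_column:
  assumes "1 \<le> j" "j < first_col \<or> last_col < j"
  shows "pconj mu j = pconj lam j"
proof -
  have "(pconj lam j, j) \<notin> D" using column_bounds[of _ j] assms by (meson not_le)
  then show ?thesis using pconj_le_if_subpart[OF lam mu sub assms(1)] assms(1) by (simp add: mem_skew)
qed

lemma bottom_cell:
  assumes "first_col \<le> j" "j \<le> last_col"
  shows "(pconj lam j, j) \<in> D" "on_bottom D (pconj lam j, j)"
  using nonempty_column[OF assms] assms first_le_last by (auto simp: mem_skew on_bottom_def)

lemma top_cell:
  assumes "first_col \<le> j" "j \<le> last_col"
  shows "(pconj mu j + 1, j) \<in> D" "on_top D (pconj mu j + 1, j)"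
  using nonempty_column[OF assms] assms first_le_last by (auto simp: mem_skew on_top_def)

lemma bottom_list: "map (bottom_content lam r) [first_col..<last_col + 1] = sorted_list_of_set bottoms"
proof -
  have "bottoms = bottom_content lam r ` {first_col..<last_col + 1}"
  proof (intro equalityI subsetI)
    fix p assume "p \<in> bottoms"
    then obtain i j where "(i, j) \<in> D" "on_bottom D (i, j)" "p = ct (i, j)" by (auto simp: bottoms_def)
    moreover from this have "i = pconj lam j" by (auto simp: mem_skew on_bottom_def)
    ultimately show "p \<in> bottom_content lam r ` {first_col..<last_col + 1}"
      using column_bounds[of i j] unfolding cont_eq by (intro image_eqI[of _ _ j]) auto
  next
    fix p assume "p \<in> bottom_content lam r ` {first_col..<last_col + 1}"
    then obtain j where "first_col \<le> j" "j \<le> last_col" "p = bottom_content lam r j" by auto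
    then show "p \<in> bottoms" using bottomsI[OF bottom_cell] unfolding cont_eq by blast
  qed
  moreover have "bottom_content lam r s < bottom_content lam r s'" if "s < s'" for s s'
    using pconj_antimono[of s s' lam] that by (simp add: rcontent_def)
  ultimately show ?thesis by (simp add: sorted_list_of_strict_mono_image del: upt_Suc)
qed

lemma top_list: "map (\<lambda>j. top_content lam mu r j + 1) [first_col..<last_col + 1] = sorted_list_of_set tops"
proof -
  have "tops = (\<lambda>j. top_content lam mu r j + 1) ` {first_col..<last_col + 1}"
  proof (intro equalityI subsetI)
    fix p assume "p \<in> tops"
    then obtain i j where ij: "(i, j) \<in> D" "on_top D (i, j)" "p = ct (i, j) + 1" by (auto simp: tops_def)
    moreover from this have "i = pconj mu j + 1" by (auto simp: mem_skew on_top_def)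
    ultimately show "p \<in> (\<lambda>j. top_content lam mu r j + 1) ` {first_col..<last_col + 1}"
      using column_bounds[of i j] unfolding cont_eq by (intro image_eqI[of _ _ j]) auto
  next
    fix p assume "p \<in> (\<lambda>j. top_content lam mu r j + 1) ` {first_col..<last_col + 1}"
    then obtain j where "first_col \<le> j" "j \<le> last_col" "p = top_content lam mu r j + 1" by auto
    then show "p \<in> tops" using topsI[OF top_cell] unfolding cont_eq by blast
  qed
  moreover have "top_content lam mu r s + 1 < top_content lam mu r s' + 1" if "s < s'" for s s'
    using pconj_antimono[of s s' mu] that by (simp add: rcontent_def)
  ultimately show ?thesis by (simp add: sorted_list_of_strict_mono_image del: upt_Suc)
qed

definition flag_top :: "(nat \<Rightarrow> int) \<Rightarrow> int \<Rightarrow> int" where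
  "flag_top a c = a (Min {snd g | g. g \<in> D \<and> cont g = c})"

definition flag_bottom :: "(nat \<Rightarrow> int) \<Rightarrow> int \<Rightarrow> int" where
  "flag_bottom b c = (let M = (THE g. g \<in> D \<and> cont g = c \<and> (\<forall>d\<in>D. cont d = c \<longrightarrow> snd d \<le> snd g))
     in b (snd M) - int (pconj lam (snd M)) + int (fst M))"

lemma flag_top_content:
  assumes "first_col \<le> j" "j \<le> last_col"
  shows "flag_top a (top_content lam mu r j) = a j"
proof -
  let ?w = "(pconj mu j + 1, j)"
  have "Min {snd g | g. g \<in> D \<and> cont g = top_content lam mu r j} = j"
  proof (rule Min_eqI)
    have "{snd g | g. g \<in> D \<and> cont g = top_content lam mu r j} \<subseteq> snd ` D" by blast
    from finite_subset[OF this] fin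
    show "finite {snd g | g. g \<in> D \<and> cont g = top_content lam mu r j}" by simp
    show "j \<in> {snd g | g. g \<in> D \<and> cont g = top_content lam mu r j}"
      using top_cell(1)[OF assms] by force
    fix s assume "s \<in> {snd g | g. g \<in> D \<and> cont g = top_content lam mu r j}"
    then obtain g where g: "g \<in> D" "ct g = ct ?w" "s = snd g" unfolding cont_eq by auto
    from on_top_min[OF top_cell[OF assms] g(1,2)] g(2,3) show "j \<le> s" by (simp add: ct_def)
  qed
  then show ?thesis by (simp add: flag_top_def)
qed

text \<open>At the bottom cell of a column the row equals the column length, so the correction in
  \<open>flag_bottom\<close> cancels.\<close>

lemma flag_bottom_content:
  assumes "first_col \<le> j" "j \<le> last_col"
  shows "flag_bottom b (bottom_content lam r j) = b j"
proof -
  let ?w = "(pconj lam j, j)"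
  have max: "snd g \<le> j" if "g \<in> D" "cont g = cont ?w" for g
    using on_bottom_max[OF bottom_cell[OF assms] that(1)] that(2) unfolding cont_eq by (simp add: ct_def)
  have "(THE g. g \<in> D \<and> cont g = cont ?w \<and> (\<forall>d\<in>D. cont d = cont ?w \<longrightarrow> snd d \<le> snd g)) = ?w"
  proof (rule the_equality)
    show "?w \<in> D \<and> cont ?w = cont ?w \<and> (\<forall>d\<in>D. cont d = cont ?w \<longrightarrow> snd d \<le> snd ?w)"
      using bottom_cell[OF assms] max by simp
    fix g assume g: "g \<in> D \<and> cont g = cont ?w \<and> (\<forall>d\<in>D. cont d = cont ?w \<longrightarrow> snd d \<le> snd g)"
    then have "snd g = j" using max[of g] bottom_cell(1)[OF assms] by fastforce
    moreover from this have "fst g = pconj lam j" using g by (simp add: rcontent_def)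
    ultimately show "g = ?w" by (simp add: prod_eq_iff)
  qed
  then show ?thesis by (simp add: flag_bottom_def)
qed

lemma Sflag_eq_minor:
  fixes y z :: "int \<Rightarrow> 'a::comm_ring_1"
  assumes N: "prow lam 1 \<le> N"
  shows "Sflag lam mu r N a b y z = minor (content_entry y z (flag_top a) (flag_bottom b)) bottoms tops"
proof -
  define F where "F i j = esuper (int (pconj lam i) - int i - int (pconj mu j) + int j) (vseg y (a j) (b i))
       (vseg z (a j + top_content lam mu r j) (b i + bottom_content lam r i))" for i j
  have "Sflag lam mu r N a b y z = mdet F [1..<N + 1] [1..<N + 1]"
    unfolding Sflag_eq_mdet_entry F_def ..
  also have "\<dots> = mdet F [first_col..<last_col + 1] [first_col..<last_col + 1]"
  proof (rule mdet_drop_unit_indices)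
    show "1 \<le> first_col" "first_col \<le> last_col + 1" "last_col + 1 \<le> N + 1"
      using first_le_last last_col_le N by auto
    show "F i i = 1" if "i \<in> {1..<first_col} \<union> {last_col + 1..<N + 1}" for i
      using empty_column[of i] that first_le_last by (auto simp: F_def)
    \<comment> \<open>Left of the shape \<open>pconj mu i = pconj lam i\<close>, which is at least
      \<open>pconj lam x\<close>; so the index of \<open>esuper\<close> is at most
      \<open>i - x\<close> and negative. Right of the shape the argument is symmetric.\<close>
    show "F x i = 0" if "i \<in> {1..<first_col}" "i < x" for i x
      using empty_column[of i] pconj_antimono[of i x lam] that by (auto simp: F_def intro!: esuper_neg)
    show "F i x = 0" if "i \<in> {last_col + 1..<N + 1}" "1 \<le> x" "x < i" for i x
      using empty_column[of i] pconj_antimono[of x i mu] that first_le_last by (auto simp: F_def intro!: esuper_neg)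
  qed
  also have "\<dots> = mdet (content_entry y z (flag_top a) (flag_bottom b))
      (map (bottom_content lam r) [first_col..<last_col + 1])
      (map (\<lambda>j. top_content lam mu r j + 1) [first_col..<last_col + 1])"
    unfolding F_def
    by (rule mdet_content_entry; rule flag_bottom_content[symmetric] flag_top_content[symmetric]) auto
  finally show ?thesis unfolding bottom_list top_list minor_def .
qed

lemma card_bottoms_tops: "card bottoms = card tops"
proof -
  have "length (sorted_list_of_set bottoms) = length (sorted_list_of_set tops)"
    unfolding bottom_list[symmetric] top_list[symmetric] by simp
  then show ?thesis by simp
qed

end

locale flagged_decomp = flagged_shape lam mu r k + ribbon_decomp "skew lam mu" k Th
  for lam mu r k Th
begin

text \<open>The empty and the undefined case are covered by unitriangularity, which flips
  preserve.\<close>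

lemma sharp_entry_eq:
  fixes y z :: "int \<Rightarrow> 'a::comm_ring_1"
  assumes t: "ti \<in> set Th" "tj \<in> set Th"
  shows "sharp_entry lam mu r Th a b y z ti tj
    = foldr flip (sorted_list_of_set turns) (content_entry y z (flag_top a) (flag_bottom b)) (head_ct ti) (tail_ct tj)"
proof -
  let ?ts = "sorted_list_of_set turns" and ?U = "content_entry y z (flag_top a) (flag_bottom b)"
  have R: "unitri (foldr flip ?ts ?U)" by (intro unitri_flips unitri_content_entry)
  define p where "p = head_ct ti"
  define q where "q = ct (rtail tj)"
  have pq: "cont (rhead ti) = p" "cont (rtail tj) = q" "tail_ct tj = q + 1"
    unfolding cont_eq p_def q_def head_ct_def tail_ct_def by auto
  consider "p = q + 1" | "p > q + 1" | "p \<le> q" by linarith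
  then show ?thesis
  proof cases
    case 1
    then show ?thesis unfolding sharp_entry_def Let_def pq p_def[symmetric] using R by (simp add: unitri_def)
  next
    case 2
    then show ?thesis unfolding sharp_entry_def Let_def pq p_def[symmetric] using R by (simp add: unitri_def)
  next
    case 3
    let ?up = "content_up D Th cont"
    have "ct (rhead D) \<le> p" "q \<le> ct (rtail D)"
      unfolding p_def q_def head_ct_def
      using ct_rhead_min(1)[OF mem_D[OF t(1) head_mem[OF t(1)]]] ct_rtail_max(1)[OF mem_D[OF t(2) tail_mem[OF t(2)]]]
      by auto
    \<comment> \<open>\<open>p\<close> and \<open>q\<close> lie between the extreme contents of
      \<open>D\<close>, so the right steps of the sub-ribbon are the turns strictly between
      \<open>p\<close> and \<open>q + 1\<close>.\<close>
    then have T: "{c + 1 | c. p \<le> c \<and> c < q \<and> \<not> ?up c} = {s \<in> set ?ts. p < s \<and> s < q + 1}"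
      unfolding cont_eq using finite_turns by (auto simp: turns_def)
    have "sharp_entry lam mu r Th a b y z ti tj
      = Sflag (strip_outer ?up p q) (strip_inner ?up p q) p (prow (strip_outer ?up p q) 1)
        (\<lambda>s. flag_top a (top_content (strip_outer ?up p q) (strip_inner ?up p q) p s))
        (\<lambda>s. flag_bottom b (bottom_content (strip_outer ?up p q) p s)) y z"
      using 3 unfolding sharp_entry_def Let_def pq flag_top_def flag_bottom_def by simp
    also have "\<dots> = foldr flip ?ts ?U p (q + 1)"
      by (rule Sflag_strip[OF 3 _ T]) simp
    finally show ?thesis unfolding pq p_def .
  qed
qed

lemma ribbon_det:
  fixes U :: "int \<Rightarrow> int \<Rightarrow> 'a::comm_ring_1"
  assumes U: "unitri U"
  shows "minor U bottoms tops
    = mdet (foldr flip (sorted_list_of_set turns) U) (map head_ct Th) (map tail_ct Th)"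
proof -
  let ?ts = "sorted_list_of_set turns"
  let ?R = "foldr flip ?ts U"
  define s where "s = (\<Sum>t | t \<in> turns \<and> (t \<in> bottoms) \<noteq> (t \<in> tops).
     card {i \<in> bottoms. i < t} + card {j \<in> tops. j \<le> t})"
  have set_ts: "set ?ts = turns" using finite_turns by simp
  have "minor U bottoms tops
    = (- 1) ^ s * minor ?R ((bottoms - turns) \<union> (turns - tops)) ((tops - turns) \<union> (turns - bottoms))"
    using minor_flips[OF U finite_bottoms finite_tops card_bottoms_tops, of ?ts]
    unfolding set_ts s_def by simp
  \<comment> \<open>Ordering the labels by \<open>Th\<close> instead of by size pairs each head with
    the tail of its own ribbon; the price is the sign of this pairing.\<close>
  also have "minor ?R ((bottoms - turns) \<union> (turns - tops)) ((tops - turns) \<union> (turns - bottoms))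
    = sdet ?R (map head_ct Th) (map tail_ct Th)"
    unfolding heads_eq[symmetric] tails_eq[symmetric] set_map[symmetric]
    by (rule minor_eq_sdet) (use distinct_Th inj_on_head_ct inj_on_tail_ct in \<open>auto simp: distinct_map\<close>)
  also have "\<dots> = of_int ((- 1) ^ s) * mdet ?R (map head_ct Th) (map tail_ct Th)"
  proof -
    have "invs (map head_ct Th) * invs (map tail_ct Th) = (- 1) ^ s"
      unfolding s_def
      by (rule invs_pairing[OF distinct_Th inj_on_head_ct inj_on_tail_ct head_le_tail finite_bottoms finite_tops
            finite_turns card_bottoms_tops heads_eq tails_eq nesting])
    then show ?thesis unfolding sdet_def by (simp only:)
  qed
  finally show ?thesis by simp
qed

end

theorem theorem5p13:
  fixes lam mu :: "nat list" and r :: int and N :: nat and a b :: "nat \<Rightarrow> int"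
    and Th :: "cell set list" and y z :: "int \<Rightarrow> 'a::comm_ring_1"
  assumes "is_partition lam" and "is_partition mu" and "subpart mu lam"
    and "edge_connected (skew lam mu)"
    and "strict_flags lam mu N a b"
    and "outer_ribbon_decomp (skew lam mu) Th"
  shows "Sflag lam mu r N a b y z =
         det (mat (length Th) (length Th)
               (\<lambda>(i, j). sharp_entry lam mu r Th a b y z (Th ! i) (Th ! j)))"
proof -
  define k where "k = r - 1 + int (pconj lam 1)"
  interpret flagged_shape lam mu r k by unfold_locales (use assms k_def in auto)
  interpret flagged_decomp lam mu r k Th by unfold_locales (use assms in auto)
  let ?U = "content_entry y z (flag_top a) (flag_bottom b)"
  have "Sflag lam mu r N a b y z = minor ?U bottoms tops"
    by (rule Sflag_eq_minor) (use assms(5) in \<open>simp add: strict_flags_def column_flags_def\<close>)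
  also have "\<dots> = mdet (foldr flip (sorted_list_of_set turns) ?U) (map head_ct Th) (map tail_ct Th)"
    by (rule ribbon_det[OF unitri_content_entry])
  also have "\<dots> = det (mat (length Th) (length Th)
               (\<lambda>(i, j). sharp_entry lam mu r Th a b y z (Th ! i) (Th ! j)))"
    unfolding mdet_def by (intro arg_cong[of _ _ det] eq_matI) (auto simp: sharp_entry_eq)
  finally show ?thesis .
qed

end
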